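(* Let $0<s<1$ be rational. There is a $\Pi^0_2$ class $G\subseteq2^\omega$ with $\mathcal H^s(G)>0$ such that the following holds: whenever $x\in2^\omega$ is such that some $\Pi^0_1(x)$ subclass of $G$ has non-zero $\mathcal H^s$-measure, then $H\le_T x$ for every hyperarithmetic $H\subseteq\omega$.
   Context: Cantor space $2^\omega$ carries the metric $d(x,y)=2^{-\min\{n:x(n)\ne y(n)\}}$ for $x\ne y$; $\mathcal H^s$ denotes $s$-dimensional Hausdorff measure with respect to this metric. $\le_T$ is Turing reducibility. *)

theory Defs
  imports Complex_Main "HOL-Library.Extended_Nonnegative_Real"
begin

definition cdist :: "(nat \<Rightarrow> bool) \<Rightarrow> (nat \<Rightarrow> bool) \<Rightarrow> real" where
  "cdist x y = (if x = y then 0 else 2 powr (- real (LEAST n. x n \<noteq> y n)))"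

definition cdiam :: "(nat \<Rightarrow> bool) set \<Rightarrow> real" where
  "cdiam A = (if A = {} then 0 else (SUP p\<in>A \<times> A. cdist (fst p) (snd p)))"

definition hausdorff_approx :: "real \<Rightarrow> real \<Rightarrow> (nat \<Rightarrow> bool) set \<Rightarrow> ennreal" where
  "hausdorff_approx s \<delta> A =
     (INF U \<in> {U :: nat \<Rightarrow> (nat \<Rightarrow> bool) set. A \<subseteq> (\<Union>i. U i) \<and> (\<forall>i. cdiam (U i) \<le> \<delta>)}.
        (\<Sum>i. ennreal (cdiam (U i) powr s)))"

definition hausdorff :: "real \<Rightarrow> (nat \<Rightarrow> bool) set \<Rightarrow> ennreal" where
  "hausdorff s A = (SUP \<delta> \<in> {0<..}. hausdorff_approx s \<delta> A)"

datatype rf = Zero | Succ | Proj nat | Comp rf "rf list" | Prim rf rf | Mu rf | Orc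

inductive eval :: "(nat \<Rightarrow> nat) \<Rightarrow> rf \<Rightarrow> nat list \<Rightarrow> nat \<Rightarrow> bool" for f where
  ev_zero: "eval f Zero xs 0"
| ev_succ: "eval f Succ (x # xs) (Suc x)"
| ev_proj: "i < length xs \<Longrightarrow> eval f (Proj i) xs (xs ! i)"
| ev_comp: "length ys = length hs \<Longrightarrow> (\<forall>i < length hs. eval f (hs ! i) xs (ys ! i))
             \<Longrightarrow> eval f g ys z \<Longrightarrow> eval f (Comp g hs) xs z"
| ev_prim0: "eval f g xs y \<Longrightarrow> eval f (Prim g h) (0 # xs) y"
| ev_primS: "eval f (Prim g h) (n # xs) y \<Longrightarrow> eval f h (y # n # xs) z
             \<Longrightarrow> eval f (Prim g h) (Suc n # xs) z"
| ev_mu: "eval f g (n # xs) 0 \<Longrightarrow> (\<forall>m < n. \<exists>k. k > 0 \<and> eval f g (m # xs) k)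
             \<Longrightarrow> eval f (Mu g) xs n"
| ev_orc: "eval f Orc (x # xs) (f x)"

definition halts :: "(nat \<Rightarrow> nat) \<Rightarrow> rf \<Rightarrow> nat list \<Rightarrow> bool" where
  "halts f c xs = (\<exists>z. eval f c xs z)"

definition chi :: "(nat \<Rightarrow> bool) \<Rightarrow> nat \<Rightarrow> nat" where
  "chi X n = (if X n then 1 else 0)"

definition join :: "(nat \<Rightarrow> bool) \<Rightarrow> (nat \<Rightarrow> bool) \<Rightarrow> nat \<Rightarrow> bool" where
  "join x y n = (if even n then x (n div 2) else y (n div 2))"

definition turing_le :: "(nat \<Rightarrow> bool) \<Rightarrow> (nat \<Rightarrow> bool) \<Rightarrow> bool" where
  "turing_le A X = (\<exists>c. \<forall>n. eval (chi X) c [n] (if A n then 1 else 0))"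

definition pi02_class :: "(nat \<Rightarrow> bool) set \<Rightarrow> bool" where
  "pi02_class G = (\<exists>c. \<forall>y. y \<in> G \<longleftrightarrow> (\<forall>n. halts (chi y) c [n]))"

definition pi01_class_rel :: "(nat \<Rightarrow> bool) \<Rightarrow> (nat \<Rightarrow> bool) set \<Rightarrow> bool" where
  "pi01_class_rel x P = (\<exists>c. \<forall>y. y \<in> P \<longleftrightarrow> \<not> halts (chi (join x y)) c [0])"

section \<open>Hyperarithmetic sets (= Delta^1_1, Kleene)\<close>

text \<open>Kleene normal form: n in H iff for all f in omega^omega the program halts on n with oracle f.\<close>
definition pi11 :: "nat set \<Rightarrow> bool" where
  "pi11 H = (\<exists>c. \<forall>n. n \<in> H \<longleftrightarrow> (\<forall>f :: nat \<Rightarrow> nat. halts f c [n]))"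

definition hyperarithmetic :: "nat set \<Rightarrow> bool" where
  "hyperarithmetic H = (pi11 H \<and> pi11 (- H))"

end

theory Submission
  imports Defs "HOL-Library.Nat_Bijection" "HOL-Probability.Probability"
begin

text \<open>Of two trees at least one is simulated by the other, that is, admits a length preserving map to
  it which preserves extension, and a simulated tree with an infinite path forces a path in the
  simulating one. If the complementary sets \<open>H\<close> and \<open>- H\<close> are the sets of inputs on which
  programs \<open>c\<close> and \<open>d\<close> halt for all oracles, then for every \<open>n\<close> exactly one of the trees of
  oracle strings on which \<open>c\<close>, respectively \<open>d\<close>, has not halted on \<open>n\<close> has a path; so the
  direction of any simulation between them tells whether \<open>n \<in> H\<close>. Being a
  simulation is a \<open>\<Pi>\<^sup>0\<^sub>2\<close> property, hence so is the class \<open>G\<close> of all points that list,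
  on a sparse set of positions, a simulation for every triple \<open>(c, d, n)\<close>, and the direction
  is a single bit of the point, the same for all points of \<open>G\<close>. By compactness a nonempty
  \<open>\<Pi>\<^sup>0\<^sub>1(x)\<close> subclass lets \<open>x\<close> compute this common bit. As the bits at the other positions are
  free, the mass distribution principle gives \<open>G\<close> positive \<open>s\<close>-dimensional measure.\<close>

section \<open>Computable functionals\<close>

lemma eval_deterministic: "eval f c xs a \<Longrightarrow> eval f c xs b \<Longrightarrow> a = b"
proof (induction arbitrary: b rule: eval.induct)
  case (ev_zero xs)
  then show ?case by cases simp
next
  case (ev_succ x xs)
  then show ?case by cases simp
next
  case (ev_proj i xs)
  from ev_proj.prems show ?case by cases simp
next
  case (ev_prim0 g xs y h)
  from ev_prim0.prems have "eval f g xs b" by cases simp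
  then show ?case by (rule ev_prim0.IH)
next
  case (ev_orc x xs)
  then show ?case by cases simp
next
  case (ev_comp ys hs xs g z)
  from ev_comp.prems obtain ys' where ys': "length ys' = length hs"
    "\<forall>i<length hs. eval f (hs ! i) xs (ys' ! i)" "eval f g ys' b"
    by cases auto
  have "ys = ys'"
    using ev_comp.hyps(1) ev_comp.IH(1) ys' by (intro nth_equalityI) auto
  then show ?case using ev_comp.IH(2) ys' by simp
next
  case (ev_primS g h n xs y z)
  from ev_primS.prems obtain y' where "eval f (Prim g h) (n # xs) y'" "eval f h (y' # n # xs) b"
    by cases auto
  then show ?case using ev_primS.IH by blast
next
  case (ev_mu g n xs)
  from ev_mu.prems have b: "eval f g (b # xs) 0" "\<forall>m<b. \<exists>k>0. eval f g (m # xs) k"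
    by (cases; simp)+
  show ?case
  proof (rule linorder_cases[of n b])
    assume "n < b"
    then obtain k where "k > 0" "eval f g (n # xs) k" using b by blast
    then show ?thesis using ev_mu.IH(1) by fastforce
  next
    assume "b < n"
    then obtain k where "k > 0" "\<forall>b'. eval f g (b # xs) b' \<longrightarrow> k = b'" using ev_mu.IH(2) by blast
    then show ?thesis using b by fastforce
  qed
qed

text \<open>One program has to serve all oracles, so that later searches can be run on an unknown
  point of Cantor space. Restricting to total functionals keeps composition free of convergence
  conditions.\<close>

definition computable :: "nat \<Rightarrow> ((nat \<Rightarrow> nat) \<Rightarrow> nat list \<Rightarrow> nat) \<Rightarrow> bool" where
  "computable m F \<longleftrightarrow> (\<exists>c. \<forall>f xs. length xs = m \<longrightarrow> eval f c xs (F f xs))"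

definition decidable :: "nat \<Rightarrow> ((nat \<Rightarrow> nat) \<Rightarrow> nat list \<Rightarrow> bool) \<Rightarrow> bool" where
  "decidable m P \<longleftrightarrow> computable m (\<lambda>f xs. of_bool (P f xs))"

text \<open>The \<open>j\<close>-th argument is written \<open>hd (tl (\<dots> xs))\<close> rather than \<open>xs ! j\<close>: bounded quantifiers and
  recursion prepend their variables to \<open>xs\<close>, and replacing \<open>xs\<close> by \<open>tl xs\<close> preserves this form.\<close>

definition suffix_selector :: "nat \<Rightarrow> (nat list \<Rightarrow> nat list) \<Rightarrow> bool" where
  "suffix_selector m T \<longleftrightarrow> (\<exists>j<m. \<forall>xs. T xs = drop j xs)"

named_theorems computable_intros

lemma computable_cong:
  assumes "computable m F" "\<And>f xs. length xs = m \<Longrightarrow> F f xs = F' f xs"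
  shows "computable m F'"
  using assms by (auto simp: computable_def)

lemma computable_comp_list:
  assumes "computable (length As) G" "\<forall>A\<in>set As. computable m A"
  shows "computable m (\<lambda>f xs. G f (map (\<lambda>A. A f xs) As))"
proof -
  obtain g where g: "\<And>f xs. length xs = length As \<Longrightarrow> eval f g xs (G f xs)"
    using assms(1) by (auto simp: computable_def)
  obtain p where p: "\<And>A f xs. A \<in> set As \<Longrightarrow> length xs = m \<Longrightarrow> eval f (p A) xs (A f xs)"
    using bchoice[OF assms(2)[unfolded computable_def]] by blast
  have "eval f (Comp g (map p As)) xs (G f (map (\<lambda>A. A f xs) As))" if "length xs = m" for f xs
    by (rule ev_comp[where ys = "map (\<lambda>A. A f xs) As"]) (use that g p in auto)
  then show ?thesis by (auto simp: computable_def)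
qed

lemma computable_comp1:
  assumes "computable 1 (\<lambda>f xs. G f (hd xs))" "computable m A"
  shows "computable m (\<lambda>f xs. G f (A f xs))"
  using computable_comp_list[of "[A]" "\<lambda>f xs. G f (hd xs)" m] assms by simp

lemma computable_comp2:
  assumes "computable 2 (\<lambda>f xs. G f (hd xs) (hd (tl xs)))" "computable m A" "computable m B"
  shows "computable m (\<lambda>f xs. G f (A f xs) (B f xs))"
  using computable_comp_list[of "[A, B]" "\<lambda>f xs. G f (hd xs) (hd (tl xs))" m] assms
  by (simp add: numeral_2_eq_2)

lemma computable_comp3:
  assumes "computable 3 (\<lambda>f xs. G f (hd xs) (hd (tl xs)) (hd (tl (tl xs))))"
    "computable m A" "computable m B" "computable m C"
  shows "computable m (\<lambda>f xs. G f (A f xs) (B f xs) (C f xs))"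
  using computable_comp_list[of "[A, B, C]" "\<lambda>f xs. G f (hd xs) (hd (tl xs)) (hd (tl (tl xs)))" m] assms
  by (simp add: numeral_3_eq_3)

lemma suffix_selector_id [simp]: "0 < m \<Longrightarrow> suffix_selector m (\<lambda>xs. xs)"
  by (auto simp: suffix_selector_def)

lemma suffix_selector_tl [simp]:
  assumes "suffix_selector (m - 1) T"
  shows "suffix_selector m (\<lambda>xs. tl (T xs))"
proof -
  obtain j where "j < m - 1" "\<forall>xs. T xs = drop j xs"
    using assms by (auto simp: suffix_selector_def)
  then show ?thesis
    unfolding suffix_selector_def by (intro exI[of _ "Suc j"]) (auto simp: tl_drop drop_Suc)
qed

lemma suffix_selector_tl' [simp]: "1 < m \<Longrightarrow> suffix_selector m tl"
  using suffix_selector_tl[of m "\<lambda>xs. xs"] by simp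

lemma computable_hd [computable_intros]:
  assumes "suffix_selector m T"
  shows "computable m (\<lambda>f xs. hd (T xs))"
proof -
  obtain j where j: "j < m" "\<forall>xs. T xs = drop j xs"
    using assms by (auto simp: suffix_selector_def)
  have "eval f (Proj j) xs (hd (T xs))" if "length xs = m" for f xs
    using j ev_proj[of j xs f] that by (simp add: hd_drop_conv_nth)
  then show ?thesis by (auto simp: computable_def)
qed

lemma computable_Suc [computable_intros]:
  assumes "computable m A"
  shows "computable m (\<lambda>f xs. Suc (A f xs))"
proof (rule computable_comp1[OF _ assms])
  have "eval f Succ xs (Suc (hd xs))" if "length xs = 1" for f xs
    using that ev_succ[of f] by (cases xs) auto
  then show "computable 1 (\<lambda>f xs. Suc (hd xs))" by (auto simp: computable_def)
qed

lemma computable_oracle [computable_intros]: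
  assumes "computable m A"
  shows "computable m (\<lambda>f xs. f (A f xs))"
proof (rule computable_comp1[OF _ assms])
  have "eval f Orc xs (f (hd xs))" if "length xs = 1" for f xs
    using that ev_orc[of f] by (cases xs) auto
  then show "computable 1 (\<lambda>f xs. f (hd xs))" by (auto simp: computable_def)
qed

lemma computable_const [computable_intros]: "computable m (\<lambda>f xs. k)"
proof (induction k)
  case 0
  then show ?case using ev_zero by (auto simp: computable_def)
next
  case (Suc k)
  then show ?case by (rule computable_Suc)
qed

lemma computable_rec [computable_intros]:
  assumes "computable m N" "computable m B"
    and "computable (Suc (Suc m)) (\<lambda>f xs. S f (hd (tl xs)) (hd xs) (tl (tl xs)))"
  shows "computable m (\<lambda>f xs. rec_nat (B f xs) (\<lambda>n y. S f n y xs) (N f xs))"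
proof -
  obtain b where b: "\<And>f xs. length xs = m \<Longrightarrow> eval f b xs (B f xs)"
    using assms(2) by (auto simp: computable_def)
  obtain s where s: "\<And>f xs. length xs = Suc (Suc m) \<Longrightarrow> eval f s xs (S f (hd (tl xs)) (hd xs) (tl (tl xs)))"
    using assms(3) by (auto simp: computable_def)
  have rec: "eval f (Prim b s) (n # xs) (rec_nat (B f xs) (\<lambda>n y. S f n y xs) n)"
    if "length xs = m" for f xs n
  proof (induction n)
    case 0
    show ?case using b[OF that] by (auto intro: ev_prim0)
  next
    case (Suc n)
    then show ?case using s[of "_ # n # xs" f] that by (auto intro!: ev_primS[OF Suc])
  qed
  define G where "G f ys = rec_nat (B f (tl ys)) (\<lambda>n y. S f n y (tl ys)) (hd ys)" for f ys
  have G: "computable (Suc m) G"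
    unfolding computable_def G_def
  proof (intro exI[of _ "Prim b s"] allI impI)
    fix f and xs :: "nat list" assume "length xs = Suc m"
    then show "eval f (Prim b s) xs (rec_nat (B f (tl xs)) (\<lambda>n y. S f n y (tl xs)) (hd xs))"
      using rec[of "tl xs" f "hd xs"] by (cases xs) auto
  qed
  \<comment> \<open>\<open>Prim\<close> expects the recursion variable at the head of its argument
    list: \<open>N\<close> supplies it, and the projections pass the parameters on
    unchanged.\<close>
  define As where "As = N # map (\<lambda>i f xs. xs ! i) [0..<m]"
  have "computable m (\<lambda>f xs. xs ! i)" if "i < m" for i
    using that ev_proj unfolding computable_def by (intro exI[of _ "Proj i"]) auto
  then have "computable m (\<lambda>f xs. G f (map (\<lambda>A. A f xs) As))"
    by (intro computable_comp_list) (use G assms(1) in \<open>auto simp: As_def\<close>)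
  then show ?thesis
  proof (rule computable_cong)
    fix f and xs :: "nat list" assume "length xs = m"
    then have "map (\<lambda>i. xs ! i) [0..<m] = xs" by (metis map_nth)
    then show "G f (map (\<lambda>A. A f xs) As) = rec_nat (B f xs) (\<lambda>n y. S f n y xs) (N f xs)"
      by (simp add: As_def G_def o_def)
  qed
qed

lemma decidable_comp2:
  assumes "decidable 2 (\<lambda>f xs. G f (hd xs) (hd (tl xs)))" "computable m A" "computable m B"
  shows "decidable m (\<lambda>f xs. G f (A f xs) (B f xs))"
  using computable_comp2[OF assms(1)[unfolded decidable_def]] assms(2,3) by (simp add: decidable_def)

lemma decidable_comp3:
  assumes "decidable 3 (\<lambda>f xs. G f (hd xs) (hd (tl xs)) (hd (tl (tl xs))))"
    "computable m A" "computable m B" "computable m C"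
  shows "decidable m (\<lambda>f xs. G f (A f xs) (B f xs) (C f xs))"
  using computable_comp3[OF assms(1)[unfolded decidable_def]] assms(2-4) by (simp add: decidable_def)

lemma computable_if [computable_intros]:
  assumes "decidable m P" "computable m A" "computable m B"
  shows "computable m (\<lambda>f xs. if P f xs then A f xs else B f xs)"
proof -
  have "computable 3 (\<lambda>f xs. rec_nat (hd (tl (tl xs))) (\<lambda>_ _. hd (tl xs)) (hd xs))"
    by (intro computable_intros) simp_all
  from computable_comp3[OF this assms(1)[unfolded decidable_def] assms(2,3)]
  show ?thesis by (rule computable_cong) auto
qed

lemma decidable_of_computable:
  assumes "computable m A"
  shows "decidable m (\<lambda>f xs. A f xs = 0)"
  unfolding decidable_def
proof (rule computable_comp1[OF _ assms])
  have "computable 1 (\<lambda>f xs. rec_nat 1 (\<lambda>_ _. 0) (hd xs))"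
    by (intro computable_intros) simp_all
  then show "computable 1 (\<lambda>f xs. of_bool (hd xs = 0))"
  proof (rule computable_cong)
    fix xs :: "nat list"
    show "rec_nat 1 (\<lambda>_ _. 0) (hd xs) = of_bool (hd xs = 0)" by (cases "hd xs") auto
  qed
qed

lemma decidable_not [computable_intros]: "decidable m P \<Longrightarrow> decidable m (\<lambda>f xs. \<not> P f xs)"
  by (drule decidable_of_computable[OF decidable_def[THEN iffD1]]) simp

lemma decidable_and [computable_intros]:
  assumes "decidable m P" "decidable m Q"
  shows "decidable m (\<lambda>f xs. P f xs \<and> Q f xs)"
proof -
  have "computable m (\<lambda>f xs. if P f xs then of_bool (Q f xs) else 0)"
    using assms by (intro computable_intros) (simp_all add: decidable_def)
  then show ?thesis unfolding decidable_def by (rule computable_cong) auto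
qed

lemma decidable_or [computable_intros]:
  assumes "decidable m P" "decidable m Q"
  shows "decidable m (\<lambda>f xs. P f xs \<or> Q f xs)"
proof -
  have "decidable m (\<lambda>f xs. \<not> (\<not> P f xs \<and> \<not> Q f xs))"
    using assms by (intro computable_intros)
  then show ?thesis by simp
qed

lemma decidable_imp [computable_intros]:
  assumes "decidable m P" "decidable m Q"
  shows "decidable m (\<lambda>f xs. P f xs \<longrightarrow> Q f xs)"
proof -
  have "decidable m (\<lambda>f xs. \<not> P f xs \<or> Q f xs)"
    using assms by (intro computable_intros)
  then show ?thesis by simp
qed

lemma computable_plus [computable_intros]:
  assumes "computable m A" "computable m B"
  shows "computable m (\<lambda>f xs. A f xs + B f xs)"
proof (rule computable_comp2[OF _ assms])
  have "rec_nat a (\<lambda>_. Suc) b = a + b" for a b by (induction b) auto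
  moreover have "computable 2 (\<lambda>f xs. rec_nat (hd xs) (\<lambda>_ y. Suc y) (hd (tl xs)))"
    by (intro computable_intros) simp_all
  ultimately show "computable 2 (\<lambda>f xs. hd xs + hd (tl xs))" by simp
qed

lemma computable_mult [computable_intros]:
  assumes "computable m A" "computable m B"
  shows "computable m (\<lambda>f xs. A f xs * B f xs)"
proof (rule computable_comp2[OF _ assms])
  have "rec_nat 0 (\<lambda>_ y. y + a) b = a * b" for a b :: nat by (induction b) auto
  moreover have "computable 2 (\<lambda>f xs. rec_nat 0 (\<lambda>_ y. y + hd xs) (hd (tl xs)))"
    by (intro computable_intros) simp_all
  ultimately show "computable 2 (\<lambda>f xs. hd xs * hd (tl xs))" by simp
qed

lemma computable_minus [computable_intros]:
  assumes "computable m A" "computable m B"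
  shows "computable m (\<lambda>f xs. A f xs - B f xs)"
proof (rule computable_comp2[OF _ assms])
  have "rec_nat 0 (\<lambda>n _. n) a = a - Suc 0" for a by (cases a) auto
  moreover have "computable 1 (\<lambda>f xs. rec_nat 0 (\<lambda>n _. n) (hd xs))"
    by (intro computable_intros) simp_all
  ultimately have "computable 1 (\<lambda>f xs. hd xs - Suc 0)" by simp
  note pred = computable_comp1[OF this]
  have "rec_nat a (\<lambda>_ y. y - Suc 0) b = a - b" for a b by (induction b) auto
  moreover have "computable 2 (\<lambda>f xs. rec_nat (hd xs) (\<lambda>_ y. y - Suc 0) (hd (tl xs)))"
    by (intro computable_intros pred) simp_all
  ultimately show "computable 2 (\<lambda>f xs. hd xs - hd (tl xs))" by simp
qed

lemma decidable_le [computable_intros]: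
  assumes "computable m A" "computable m B"
  shows "decidable m (\<lambda>f xs. A f xs \<le> B f xs)"
  using decidable_of_computable[OF computable_minus[OF assms]] by simp

lemma decidable_less [computable_intros]:
  assumes "computable m A" "computable m B"
  shows "decidable m (\<lambda>f xs. A f xs < B f xs)"
  using decidable_le[OF computable_Suc[OF assms(1)] assms(2)] by (simp add: Suc_le_eq)

lemma decidable_eq [computable_intros]:
  assumes "computable m A" "computable m B"
  shows "decidable m (\<lambda>f xs. A f xs = B f xs)"
  using decidable_and[OF decidable_le[OF assms] decidable_le[OF assms(2,1)]]
  by (simp add: eq_iff)

lemma decidable_bounded_ex [computable_intros]:
  assumes "computable m B" "decidable (Suc m) (\<lambda>f xs. P f (hd xs) (tl xs))"
  shows "decidable m (\<lambda>f xs. \<exists>i<B f xs. P f i xs)"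
proof -
  \<comment> \<open>In the recursion below the argument list begins with the accumulated value,
    followed by the bound variable. These projections remove the former.\<close>
  define As where "As = map (\<lambda>i (f::nat \<Rightarrow> nat) (xs::nat list). xs ! Suc i) [0..<Suc m]"
  have As: "map (\<lambda>A. A f xs) As = tl xs" if "length xs = Suc (Suc m)" for f and xs :: "nat list"
    using that by (auto simp: As_def intro!: nth_equalityI simp: nth_tl simp del: upt_Suc)
  have "computable (Suc (Suc m)) (\<lambda>f xs. xs ! Suc i)" if "i < Suc m" for i
    using that ev_proj unfolding computable_def by (intro exI[of _ "Proj (Suc i)"]) auto
  then have "computable (Suc (Suc m)) (\<lambda>f xs. of_bool (P f (hd (map (\<lambda>A. A f xs) As)) (tl (map (\<lambda>A. A f xs) As))))"
    using assms(2) unfolding decidable_def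
    by (intro computable_comp_list[of As "\<lambda>f xs. of_bool (P f (hd xs) (tl xs))"])
       (auto simp: As_def simp del: upt_Suc)
  then have "decidable (Suc (Suc m)) (\<lambda>f xs. P f (hd (tl xs)) (tl (tl xs)))"
    unfolding decidable_def by (rule computable_cong) (simp add: As)
  then have "computable m (\<lambda>f xs. rec_nat 0 (\<lambda>i y. if P f i xs then 1 else y) (B f xs))"
    using assms(1) by (intro computable_intros) simp_all
  moreover have "rec_nat (0::nat) (\<lambda>i y. if R i then 1 else y) b = of_bool (\<exists>i<b. R i)" for R b
    by (induction b) (auto simp: less_Suc_eq)
  ultimately show ?thesis by (simp add: decidable_def)
qed

lemma decidable_bounded_all [computable_intros]:
  assumes "computable m B" "decidable (Suc m) (\<lambda>f xs. P f (hd xs) (tl xs))"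
  shows "decidable m (\<lambda>f xs. \<forall>i<B f xs. P f i xs)"
  using decidable_not[OF decidable_bounded_ex[OF assms(1) decidable_not[OF assms(2)]]] by simp

section \<open>Pairing and its inverse\<close>

lemma computable_triangle:
  assumes "computable m A"
  shows "computable m (\<lambda>f xs. triangle (A f xs))"
proof (rule computable_comp1[OF _ assms])
  have "rec_nat 0 (\<lambda>n y. y + Suc n) n = triangle n" for n by (induction n) auto
  moreover have "computable 1 (\<lambda>f xs. rec_nat 0 (\<lambda>n y. y + Suc n) (hd xs))"
    by (intro computable_intros) simp_all
  ultimately show "computable 1 (\<lambda>f xs. triangle (hd xs))" by simp
qed

lemma computable_pair [computable_intros]:
  assumes "computable m A" "computable m B"
  shows "computable m (\<lambda>f xs. prod_encode (A f xs, B f xs))"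
  unfolding prod_encode_def using assms
  by (simp add: computable_triangle computable_plus)

definition pfst :: "nat \<Rightarrow> nat" where "pfst n = fst (prod_decode n)"
definition psnd :: "nat \<Rightarrow> nat" where "psnd n = snd (prod_decode n)"

lemma pfst_pair [simp]: "pfst (prod_encode (a, b)) = a"
  and psnd_pair [simp]: "psnd (prod_encode (a, b)) = b"
  by (simp_all add: pfst_def psnd_def)

lemma pair_pfst_psnd: "prod_encode (pfst n, psnd n) = n"
  by (simp add: pfst_def psnd_def)

lemma pair_bounds: "pfst n \<le> n" "psnd n \<le> n"
  using le_prod_encode_1[of "pfst n" "psnd n"] le_prod_encode_2[of "psnd n" "pfst n"]
  by (simp_all add: pair_pfst_psnd)

text \<open>Serves to invert the pairing by primitive recursion: the recursion keeps the last
  witness below the bound, and uniqueness makes that the wanted one.\<close>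

lemma rec_nat_unique_witness:
  assumes "R a" "\<And>i. R i \<Longrightarrow> i = a" "a < b"
  shows "rec_nat 0 (\<lambda>i y. if R i then i else y) b = a"
proof -
  have R: "R i \<longleftrightarrow> i = a" for i using assms(1,2) by blast
  have "rec_nat 0 (\<lambda>i y. if R i then i else y) b = (if a < b then a else 0)"
    unfolding R by (induction b) auto
  then show ?thesis using assms(3) by simp
qed

lemma computable_pfst [computable_intros]:
  assumes "computable m A"
  shows "computable m (\<lambda>f xs. pfst (A f xs))"
proof (rule computable_comp1[OF _ assms])
  have "rec_nat 0 (\<lambda>i y. if \<exists>k<Suc n. prod_encode (i, k) = n then i else y) (Suc n) = pfst n" for n
    using pair_bounds[of n] by (intro rec_nat_unique_witness) (auto simp: pair_pfst_psnd less_Suc_eq_le)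
  moreover have "computable 1 (\<lambda>f xs. rec_nat 0 (\<lambda>i y. if \<exists>k<Suc (hd xs). prod_encode (i, k) = hd xs then i else y) (Suc (hd xs)))"
    by (intro computable_intros) simp_all
  ultimately show "computable 1 (\<lambda>f xs. pfst (hd xs))" by simp
qed

lemma computable_psnd [computable_intros]:
  assumes "computable m A"
  shows "computable m (\<lambda>f xs. psnd (A f xs))"
proof (rule computable_comp1[OF _ assms])
  have "rec_nat 0 (\<lambda>i y. if \<exists>k<Suc n. prod_encode (k, i) = n then i else y) (Suc n) = psnd n" for n
    using pair_bounds[of n] by (intro rec_nat_unique_witness) (auto simp: pair_pfst_psnd less_Suc_eq_le)
  moreover have "computable 1 (\<lambda>f xs. rec_nat 0 (\<lambda>i y. if \<exists>k<Suc (hd xs). prod_encode (k, i) = hd xs then i else y) (Suc (hd xs)))"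
    by (intro computable_intros) simp_all
  ultimately show "computable 1 (\<lambda>f xs. psnd (hd xs))" by simp
qed

lemma decidable_comp4:
  assumes "decidable 4 (\<lambda>f xs. G f (hd xs) (hd (tl xs)) (hd (tl (tl xs))) (hd (tl (tl (tl xs)))))"
    "computable m A" "computable m B" "computable m C" "computable m D"
  shows "decidable m (\<lambda>f xs. G f (A f xs) (B f xs) (C f xs) (D f xs))"
  using computable_comp_list[of "[A, B, C, D]"
      "\<lambda>f xs. of_bool (G f (hd xs) (hd (tl xs)) (hd (tl (tl xs))) (hd (tl (tl (tl xs)))))" m] assms
  by (simp add: decidable_def eval_nat_numeral)

section \<open>Unbounded search\<close>

lemma ex_eval_search:
  assumes "decidable (Suc m) (\<lambda>f xs. P f (hd xs) (tl xs))"
  shows "\<exists>c. \<forall>f xs. length xs = m \<longrightarrow>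
    ((\<exists>i. P f i xs) \<longrightarrow> eval f c xs (LEAST i. P f i xs)) \<and> (halts f c xs \<longrightarrow> (\<exists>i. P f i xs))"
proof -
  \<comment> \<open>\<open>Mu\<close> searches for a zero, hence the characteristic function of the
    negation.\<close>
  obtain p where p: "\<And>f xs. length xs = Suc m \<Longrightarrow> eval f p xs (of_bool (\<not> P f (hd xs) (tl xs)))"
    using decidable_not[OF assms] by (auto simp: decidable_def computable_def)
  have p': "eval f p (i # xs) (of_bool (\<not> P f i xs))" if "length xs = m" for f i xs
    using p[of "i # xs" f] that by simp
  have "eval f (Mu p) xs (LEAST i. P f i xs)" if len: "length xs = m" and ex: "\<exists>i. P f i xs" for f xs
  proof (rule ev_mu)
    show "eval f p ((LEAST i. P f i xs) # xs) 0"
      using p'[OF len, of f "LEAST i. P f i xs"] LeastI_ex[OF ex] by simp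
    show "\<forall>i<(LEAST i. P f i xs). \<exists>k>0. eval f p (i # xs) k"
    proof (intro allI impI)
      fix i assume "i < (LEAST i. P f i xs)"
      then have "\<not> P f i xs" by (rule not_less_Least)
      then show "\<exists>k>0. eval f p (i # xs) k" using p'[OF len, of f i] by auto
    qed
  qed
  moreover have "\<exists>i. P f i xs" if len: "length xs = m" and h: "halts f (Mu p) xs" for f xs
  proof -
    obtain i where "eval f (Mu p) xs i" using h by (auto simp: halts_def)
    then have "eval f p (i # xs) 0" by cases
    then show "\<exists>i. P f i xs" using eval_deterministic[OF p'[OF len]] by force
  qed
  ultimately show ?thesis by blast
qed

lemma ex_halts_iff_ex:
  assumes "decidable (Suc m) (\<lambda>f xs. P f (hd xs) (tl xs))"
  shows "\<exists>c. \<forall>f xs. length xs = m \<longrightarrow> (halts f c xs \<longleftrightarrow> (\<exists>i. P f i xs))"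
  using ex_eval_search[OF assms] unfolding halts_def by blast

lemma ex_eval_Least:
  assumes "decidable (Suc m) (\<lambda>f xs. P f (hd xs) (tl xs))" "computable (Suc m) (\<lambda>f xs. F f (hd xs) (tl xs))"
  shows "\<exists>c. \<forall>f xs. length xs = m \<longrightarrow> (\<exists>i. P f i xs) \<longrightarrow> eval f c xs (F f (LEAST i. P f i xs) xs)"
proof -
  obtain p where p: "\<And>f xs. length xs = m \<Longrightarrow> \<exists>i. P f i xs \<Longrightarrow> eval f p xs (LEAST i. P f i xs)"
    using ex_eval_search[OF assms(1)] by blast
  obtain q where q: "\<And>f xs. length xs = Suc m \<Longrightarrow> eval f q xs (F f (hd xs) (tl xs))"
    using assms(2) by (auto simp: computable_def)
  have "eval f (Comp q (p # map Proj [0..<m])) xs (F f (LEAST i. P f i xs) xs)"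
    if len: "length xs = m" and ex: "\<exists>i. P f i xs" for f xs
  proof (rule ev_comp[where ys = "(LEAST i. P f i xs) # xs"])
    show "\<forall>i<length (p # map Proj [0..<m]).
        eval f ((p # map Proj [0..<m]) ! i) xs (((LEAST i. P f i xs) # xs) ! i)"
      using len p[OF len ex] by (auto simp: nth_Cons less_Suc_eq_0_disj intro: ev_proj split: nat.split)
    show "eval f q ((LEAST i. P f i xs) # xs) (F f (LEAST i. P f i xs) xs)"
      using q[of "(LEAST i. P f i xs) # xs" f] len by simp
  qed (use len in simp)
  then show ?thesis by blast
qed

section \<open>Finite lists coded as numbers\<close>

definition lcons :: "nat \<Rightarrow> nat \<Rightarrow> nat" where "lcons a l = Suc (prod_encode (a, l))"
definition lhd :: "nat \<Rightarrow> nat" where "lhd l = pfst (l - 1)"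
definition ltl :: "nat \<Rightarrow> nat" where "ltl l = psnd (l - 1)"
definition ldrop :: "nat \<Rightarrow> nat \<Rightarrow> nat" where "ldrop l i = rec_nat l (\<lambda>_ y. ltl y) i"
definition lnth :: "nat \<Rightarrow> nat \<Rightarrow> nat" where "lnth l i = lhd (ldrop l i)"
text \<open>The last nonempty tail determines the length. Recursing up to \<open>l\<close> reaches
  it, as no list is longer than its code.\<close>

definition llen :: "nat \<Rightarrow> nat" where
  "llen l = rec_nat 0 (\<lambda>n y. if ldrop l n = 0 then y else Suc n) l"
definition lmem :: "nat \<Rightarrow> nat \<Rightarrow> bool" where "lmem x l \<longleftrightarrow> (\<exists>i<llen l. lnth l i = x)"

lemma lcons_list_encode [simp]: "lcons a (list_encode xs) = list_encode (a # xs)"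
  by (simp add: lcons_def)

lemma list_encode_eq_0_iff [simp]: "list_encode xs = 0 \<longleftrightarrow> xs = []"
  by (cases xs) auto

lemma list_encode_pos_iff [simp]: "0 < list_encode xs \<longleftrightarrow> xs \<noteq> []"
  by (cases xs) auto

lemma lhd_list_encode [simp]: "xs \<noteq> [] \<Longrightarrow> lhd (list_encode xs) = hd xs"
  by (cases xs) (auto simp: lhd_def)

lemma ltl_list_encode [simp]: "ltl (list_encode xs) = list_encode (tl xs)"
  using pair_bounds(2)[of 0] by (cases xs) (auto simp: ltl_def)

lemma ldrop_list_encode [simp]: "ldrop (list_encode xs) i = list_encode (drop i xs)"
  by (induction i) (auto simp: ldrop_def drop_Suc tl_drop)

lemma lnth_list_encode [simp]: "i < length xs \<Longrightarrow> lnth (list_encode xs) i = xs ! i"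
  by (simp add: lnth_def hd_drop_conv_nth)

lemma length_le_list_encode: "length xs \<le> list_encode xs"
proof (induction xs)
  case (Cons x xs)
  then show ?case using le_prod_encode_2[of "list_encode xs" x] by simp
qed simp

lemma llen_list_encode [simp]: "llen (list_encode xs) = length xs"
proof -
  have "rec_nat 0 (\<lambda>n y. if ldrop (list_encode xs) n = 0 then y else Suc n) b = min b (length xs)" for b
    by (induction b) (auto simp: min_def)
  then show ?thesis using length_le_list_encode[of xs] by (simp add: llen_def)
qed

lemma lmem_list_encode [simp]: "lmem x (list_encode xs) \<longleftrightarrow> x \<in> set xs"
  by (auto simp: lmem_def in_set_conv_nth)

lemma list_encode_mem_less: "x \<in> set xs \<Longrightarrow> x < list_encode xs"
proof (induction xs)
  case (Cons y xs)
  then show ?case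
    using le_prod_encode_1[of y "list_encode xs"] le_prod_encode_2[of "list_encode xs" y] by auto
qed simp

declare list_encode.simps(2) [simp del]

lemma lmem_less: "lmem x D \<Longrightarrow> x < D"
  by (metis list_decode_inverse lmem_list_encode list_encode_mem_less)

lemma computable_lcons [computable_intros]:
  "computable m A \<Longrightarrow> computable m B \<Longrightarrow> computable m (\<lambda>f xs. lcons (A f xs) (B f xs))"
  unfolding lcons_def by (intro computable_intros)

lemma computable_lhd [computable_intros]: "computable m A \<Longrightarrow> computable m (\<lambda>f xs. lhd (A f xs))"
  unfolding lhd_def by (intro computable_intros)

lemma computable_ltl [computable_intros]: "computable m A \<Longrightarrow> computable m (\<lambda>f xs. ltl (A f xs))"
  unfolding ltl_def by (intro computable_intros)

lemma computable_ldrop [computable_intros]: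
  assumes "computable m A" "computable m B"
  shows "computable m (\<lambda>f xs. ldrop (A f xs) (B f xs))"
  unfolding ldrop_def
  by (rule computable_comp2[OF _ assms]) (intro computable_intros; simp)

lemma computable_lnth [computable_intros]:
  "computable m A \<Longrightarrow> computable m B \<Longrightarrow> computable m (\<lambda>f xs. lnth (A f xs) (B f xs))"
  unfolding lnth_def by (intro computable_intros)

lemma computable_llen [computable_intros]:
  assumes "computable m A"
  shows "computable m (\<lambda>f xs. llen (A f xs))"
  unfolding llen_def
  by (rule computable_comp1[OF _ assms]) (intro computable_intros; simp)

lemma decidable_lmem [computable_intros]:
  assumes "computable m A" "computable m B"
  shows "decidable m (\<lambda>f xs. lmem (A f xs) (B f xs))"
  unfolding lmem_def
  by (rule decidable_comp2[OF _ assms]) (intro computable_intros; simp)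

section \<open>Derivations of halting computations\<close>

text \<open>Oracle strings are stored in reverse, so that extending a string is \<^const>\<open>lcons\<close>.\<close>

definition rprefix :: "(nat \<Rightarrow> nat) \<Rightarrow> nat \<Rightarrow> nat" where
  "rprefix f k = list_encode (rev (map f [0..<k]))"

text \<open>Because strings are stored in reverse, positions are counted from the end; then
  \<open>lcons\<close> leaves earlier entries in place.\<close>

definition lookup :: "nat \<Rightarrow> nat \<Rightarrow> nat \<Rightarrow> bool" where
  "lookup s x v \<longleftrightarrow> x < llen s \<and> lnth s (llen s - Suc x) = v"

lemma rprefix_0 [simp]: "rprefix f 0 = 0"
  by (simp add: rprefix_def)

lemma rprefix_Suc [simp]: "rprefix f (Suc k) = lcons (f k) (rprefix f k)"
  by (simp add: rprefix_def)

lemma lookup_list_encode: "lookup (list_encode xs) x v \<longleftrightarrow> x < length xs \<and> rev xs ! x = v"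
  by (auto simp: lookup_def rev_nth)

lemma lookup_rprefix [simp]: "lookup (rprefix f k) x v \<longleftrightarrow> x < k \<and> f x = v"
  by (auto simp: rprefix_def lookup_list_encode)

lemma lookup_lcons:
  assumes "lookup s x v"
  shows "lookup (lcons a s) x v"
proof -
  have "lookup (lcons a (list_encode xs)) x v" if "lookup (list_encode xs) x v" for xs
    using that unfolding lcons_list_encode by (auto simp: lookup_list_encode nth_append)
  from this[of "list_decode s"] show ?thesis using assms by simp
qed

lemma decidable_lookup [computable_intros]:
  "computable m A \<Longrightarrow> computable m B \<Longrightarrow> computable m C \<Longrightarrow> decidable m (\<lambda>f xs. lookup (A f xs) (B f xs) (C f xs))"
  unfolding lookup_def by (intro computable_intros)

section \<open>Codes of programs and facts\<close>

primrec code :: "rf \<Rightarrow> nat" where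
  "code Zero = prod_encode (0, 0)"
| "code Succ = prod_encode (1, 0)"
| "code (Proj i) = prod_encode (2, i)"
| "code (Comp g hs) = prod_encode (3, prod_encode (code g, list_encode (map code hs)))"
| "code (Prim g h) = prod_encode (4, prod_encode (code g, code h))"
| "code (Mu g) = prod_encode (5, code g)"
| "code Orc = prod_encode (6, 0)"

text \<open>A fact is a number coding the assertion that program \<open>e\<close> has value \<open>v\<close> on the argument list
  \<open>xs\<close>; it is justified by the list \<open>D\<close> of facts if it follows from them by one rule of \<^const>\<open>eval\<close>.\<close>

definition fact_code :: "nat \<Rightarrow> nat \<Rightarrow> nat \<Rightarrow> nat" where
  "fact_code e xs v = prod_encode (e, prod_encode (xs, v))"

text \<open>The bound \<open>D\<close> makes the search decidable and excludes nothing: members of a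
  coded list are smaller than its code, and the components of a fact do not exceed the fact. The two
  predicates below are bounded in the same way.\<close>

definition justified_comp :: "nat \<Rightarrow> nat \<Rightarrow> nat \<Rightarrow> nat \<Rightarrow> bool" where
  "justified_comp D a xs v \<longleftrightarrow>
     (\<exists>ys<D. lmem (fact_code (pfst a) ys v) D \<and> llen ys = llen (psnd a) \<and>
       (\<forall>j<llen ys. lmem (fact_code (lnth (psnd a) j) xs (lnth ys j)) D))"

definition justified_prim :: "nat \<Rightarrow> nat \<Rightarrow> nat \<Rightarrow> nat \<Rightarrow> bool" where
  "justified_prim D e xs v \<longleftrightarrow> xs \<noteq> 0 \<and>
     (lhd xs = 0 \<and> lmem (fact_code (pfst (psnd e)) (ltl xs) v) D \<or>
      lhd xs \<noteq> 0 \<and> (\<exists>y<D. lmem (fact_code e (lcons (lhd xs - 1) (ltl xs)) y) D \<and>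
        lmem (fact_code (psnd (psnd e)) (lcons y (lcons (lhd xs - 1) (ltl xs))) v) D))"

definition justified_mu :: "nat \<Rightarrow> nat \<Rightarrow> nat \<Rightarrow> nat \<Rightarrow> bool" where
  "justified_mu D a xs v \<longleftrightarrow> lmem (fact_code a (lcons v xs) 0) D \<and>
     (\<forall>i<v. \<exists>k<D. k > 0 \<and> lmem (fact_code a (lcons i xs) k) D)"

definition justified :: "nat \<Rightarrow> nat \<Rightarrow> nat \<Rightarrow> bool" where
  "justified s D F \<longleftrightarrow> (let e = pfst F; xs = pfst (psnd F); v = psnd (psnd F); a = psnd e in
     pfst e = 0 \<and> v = 0 \<or>
     pfst e = 1 \<and> xs \<noteq> 0 \<and> v = Suc (lhd xs) \<or>
     pfst e = 2 \<and> a < llen xs \<and> v = lnth xs a \<or>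
     pfst e = 3 \<and> justified_comp D a xs v \<or>
     pfst e = 4 \<and> justified_prim D e xs v \<or>
     pfst e = 5 \<and> justified_mu D a xs v \<or>
     pfst e = 6 \<and> xs \<noteq> 0 \<and> lookup s (lhd xs) v)"

text \<open>The newest fact comes first, so each entry appeals to the entries behind it. Appeals are
  thus well-founded, which soundness needs.\<close>

definition derivation :: "nat \<Rightarrow> nat \<Rightarrow> bool" where
  "derivation s t \<longleftrightarrow> (\<forall>i<llen t. justified s (ldrop t (Suc i)) (lnth t i))"

definition derives_halt :: "nat \<Rightarrow> nat \<Rightarrow> nat \<Rightarrow> nat \<Rightarrow> bool" where
  "derives_halt e n s t \<longleftrightarrow> derivation s t \<and> (\<exists>v<t. lmem (fact_code e (lcons n 0) v) t)"

lemma fact_code_inject [simp]: "fact_code e xs v = fact_code e' xs' v' \<longleftrightarrow> e = e' \<and> xs = xs' \<and> v = v'"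
  by (simp add: fact_code_def)

lemma computable_fact_code [computable_intros]:
  "computable m A \<Longrightarrow> computable m B \<Longrightarrow> computable m C \<Longrightarrow> computable m (\<lambda>f xs. fact_code (A f xs) (B f xs) (C f xs))"
  unfolding fact_code_def by (intro computable_intros)

lemma decidable_justified_comp [computable_intros]:
  assumes "computable m A" "computable m B" "computable m C" "computable m D"
  shows "decidable m (\<lambda>f xs. justified_comp (A f xs) (B f xs) (C f xs) (D f xs))"
  unfolding justified_comp_def
  by (rule decidable_comp4[OF _ assms]) (intro computable_intros; simp)

lemma decidable_justified_prim [computable_intros]:
  assumes "computable m A" "computable m B" "computable m C" "computable m D"
  shows "decidable m (\<lambda>f xs. justified_prim (A f xs) (B f xs) (C f xs) (D f xs))"
  unfolding justified_prim_def
  by (rule decidable_comp4[OF _ assms]) (intro computable_intros; simp)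

lemma decidable_justified_mu [computable_intros]:
  assumes "computable m A" "computable m B" "computable m C" "computable m D"
  shows "decidable m (\<lambda>f xs. justified_mu (A f xs) (B f xs) (C f xs) (D f xs))"
  unfolding justified_mu_def
  by (rule decidable_comp4[OF _ assms]) (intro computable_intros; simp)

lemma decidable_justified [computable_intros]:
  assumes "computable m A" "computable m B" "computable m C"
  shows "decidable m (\<lambda>f xs. justified (A f xs) (B f xs) (C f xs))"
  unfolding justified_def Let_def
  by (rule decidable_comp3[OF _ assms]) (intro computable_intros; simp)

lemma decidable_derivation [computable_intros]:
  assumes "computable m A" "computable m B"
  shows "decidable m (\<lambda>f xs. derivation (A f xs) (B f xs))"
  unfolding derivation_def
  by (rule decidable_comp2[OF _ assms]) (intro computable_intros; simp)

lemma decidable_derives_halt [computable_intros]: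
  assumes "computable m A" "computable m B" "computable m C" "computable m D"
  shows "decidable m (\<lambda>f xs. derives_halt (A f xs) (B f xs) (C f xs) (D f xs))"
  unfolding derives_halt_def
  by (rule decidable_comp4[OF _ assms]) (intro computable_intros; simp)

lemma lmem_fact_bounds:
  assumes "lmem (fact_code e ys v) D"
  shows "ys < D" "v < D"
  using lmem_less[OF assms] pair_bounds(1)[of "prod_encode (ys, v)"]
    pair_bounds(2)[of "prod_encode (ys, v)"] pair_bounds(2)[of "fact_code e ys v"]
  by (auto simp: fact_code_def)

lemma justified_comp_iff:
  "justified_comp D a xs v \<longleftrightarrow>
     (\<exists>ys. lmem (fact_code (pfst a) ys v) D \<and> llen ys = llen (psnd a) \<and>
       (\<forall>j<llen ys. lmem (fact_code (lnth (psnd a) j) xs (lnth ys j)) D))"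
  unfolding justified_comp_def using lmem_fact_bounds by blast

lemma justified_prim_iff:
  "justified_prim D e xs v \<longleftrightarrow> xs \<noteq> 0 \<and>
     (lhd xs = 0 \<and> lmem (fact_code (pfst (psnd e)) (ltl xs) v) D \<or>
      lhd xs \<noteq> 0 \<and> (\<exists>y. lmem (fact_code e (lcons (lhd xs - 1) (ltl xs)) y) D \<and>
        lmem (fact_code (psnd (psnd e)) (lcons y (lcons (lhd xs - 1) (ltl xs))) v) D))"
  unfolding justified_prim_def using lmem_fact_bounds by blast

lemma justified_mu_iff:
  "justified_mu D a xs v \<longleftrightarrow> lmem (fact_code a (lcons v xs) 0) D \<and>
     (\<forall>i<v. \<exists>k. k > 0 \<and> lmem (fact_code a (lcons i xs) k) D)"
  unfolding justified_mu_def using lmem_fact_bounds by blast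

text \<open>Once the search bounds are removed, membership in \<open>D\<close> and
  \<open>lookup\<close> occur only positively in every rule. So justifications survive extra facts
  and longer oracle strings.\<close>

lemma justified_mono:
  assumes "justified s D F" "\<And>x. lmem x D \<Longrightarrow> lmem x E" "\<And>x v. lookup s x v \<Longrightarrow> lookup s' x v"
  shows "justified s' E F"
proof -
  have "justified_comp D a xs v \<Longrightarrow> justified_comp E a xs v" for a xs v
    unfolding justified_comp_iff using assms(2) by blast
  moreover have "justified_prim D a xs v \<Longrightarrow> justified_prim E a xs v" for a xs v
    unfolding justified_prim_iff using assms(2) by blast
  moreover have "justified_mu D a xs v \<Longrightarrow> justified_mu E a xs v" for a xs v
    unfolding justified_mu_iff using assms(2) by blast
  ultimately show ?thesis
    using assms(1,3) unfolding justified_def Let_def by blast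
qed

lemma derivation_0 [simp]: "derivation s 0"
  using llen_list_encode[of "[]"] by (simp add: derivation_def del: llen_list_encode)

lemma derivation_Cons [simp]:
  "derivation s (list_encode (x # ts)) \<longleftrightarrow> justified s (list_encode ts) x \<and> derivation s (list_encode ts)"
proof -
  have "derivation s (list_encode us) \<longleftrightarrow>
      (\<forall>i<length us. justified s (list_encode (drop (Suc i) us)) (us ! i))" for us
    by (auto simp: derivation_def)
  then show ?thesis by (auto simp: All_less_Suc2)
qed

lemma derivation_mono:
  assumes "derivation s t" "\<And>x v. lookup s x v \<Longrightarrow> lookup s' x v"
  shows "derivation s' t"
  unfolding derivation_def
proof (intro allI impI)
  fix i assume "i < llen t"
  then have "justified s (ldrop t (Suc i)) (lnth t i)"
    using assms(1) by (simp add: derivation_def)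
  then show "justified s' (ldrop t (Suc i)) (lnth t i)"
    by (rule justified_mono) (assumption | rule assms(2))+
qed

lemma derivation_append:
  "derivation s (list_encode ts) \<Longrightarrow> derivation s (list_encode us) \<Longrightarrow> derivation s (list_encode (ts @ us))"
proof (induction ts)
  case (Cons x ts)
  then have "justified s (list_encode ts) x" by simp
  then have "justified s (list_encode (ts @ us)) x" by (rule justified_mono) auto
  then show ?case using Cons by simp
qed simp

section \<open>Soundness of derivations\<close>

lemma justified_sound:
  assumes "justified (rprefix f k) D (fact_code (code c) (list_encode xs) v)"
    and IH: "\<And>c xs v. lmem (fact_code (code c) (list_encode xs) v) D \<Longrightarrow> eval f c xs v"
  shows "eval f c xs v"
proof (cases c)
  case Zero
  then show ?thesis using assms(1) by (auto simp: justified_def fact_code_def intro: ev_zero)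
next
  case Succ
  then show ?thesis
    using assms(1) by (cases xs) (auto simp: justified_def fact_code_def intro: ev_succ)
next
  case (Proj i)
  then show ?thesis
    using assms(1) by (auto simp: justified_def fact_code_def intro: ev_proj)
next
  case (Comp g hs)
  then have "justified_comp D (prod_encode (code g, list_encode (map code hs))) (list_encode xs) v"
    using assms(1) by (simp add: justified_def fact_code_def)
  then obtain y where y: "lmem (fact_code (code g) y v) D" "llen y = length hs"
    "\<forall>j<llen y. lmem (fact_code (lnth (list_encode (map code hs)) j) (list_encode xs) (lnth y j)) D"
    unfolding justified_comp_iff by auto
  define ys where "ys = list_decode y"
  have y_eq: "y = list_encode ys" by (simp add: ys_def)
  show ?thesis unfolding Comp
  proof (rule ev_comp[where ys = ys])
    show "length ys = length hs" using y(2) by (simp add: y_eq)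
    then show "\<forall>i<length hs. eval f (hs ! i) xs (ys ! i)"
      using y(3) IH by (auto simp: y_eq)
    show "eval f g ys v" using y(1) IH by (simp add: y_eq)
  qed
next
  case (Prim g h)
  then have *: "justified_prim D (code c) (list_encode xs) v"
    using assms(1) by (simp add: justified_def fact_code_def)
  then obtain n zs where xs: "xs = n # zs"
    unfolding justified_prim_iff by (cases xs) auto
  show ?thesis
  proof (cases n)
    case 0
    then show ?thesis
      using * IH[of g zs v] unfolding justified_prim_iff xs Prim
      by (auto intro: ev_prim0)
  next
    case (Suc n')
    then obtain y where "lmem (fact_code (code c) (list_encode (n' # zs)) y) D"
      "lmem (fact_code (code h) (list_encode (y # n' # zs)) v) D"
      using * unfolding justified_prim_iff xs Prim by auto
    then show ?thesis unfolding xs Suc Prim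
      using IH by (intro ev_primS[where y = y]) (auto simp: Prim)
  qed
next
  case (Mu g)
  then have "justified_mu D (code g) (list_encode xs) v"
    using assms(1) by (simp add: justified_def fact_code_def)
  then show ?thesis
    unfolding justified_mu_iff Mu lcons_list_encode using IH by (intro ev_mu) blast+
next
  case Orc
  then show ?thesis
    using assms(1) by (cases xs) (auto simp: justified_def fact_code_def intro: ev_orc)
qed

lemma derivation_sound:
  assumes "derivation (rprefix f k) (list_encode ts)" "fact_code (code c) (list_encode xs) v \<in> set ts"
  shows "eval f c xs v"
  using assms
proof (induction ts arbitrary: c xs v)
  case (Cons x ts)
  have IH: "eval f c xs v" if "lmem (fact_code (code c) (list_encode xs) v) (list_encode ts)" for c xs v
    using Cons that by simp
  from Cons.prems show ?case
    using IH justified_sound[of f k "list_encode ts"] by auto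
qed simp

section \<open>Completeness of derivations\<close>

definition derivable :: "(nat \<Rightarrow> nat) \<Rightarrow> nat set \<Rightarrow> bool" where
  "derivable f S \<longleftrightarrow> (\<exists>k ts. derivation (rprefix f k) (list_encode ts) \<and> S \<subseteq> set ts)"

lemma derivable_Un:
  assumes "derivable f S" "derivable f T"
  shows "derivable f (S \<union> T)"
proof -
  obtain k ts l us where ts: "derivation (rprefix f k) (list_encode ts)" "S \<subseteq> set ts"
    and us: "derivation (rprefix f l) (list_encode us)" "T \<subseteq> set us"
    using assms by (auto simp: derivable_def)
  have "derivation (rprefix f (max k l)) (list_encode (ts @ us))"
    using ts(1) us(1) by (intro derivation_append) (erule derivation_mono, auto)+
  then show ?thesis
    using ts(2) us(2) unfolding derivable_def
    by (intro exI[of _ "max k l"] exI[of _ "ts @ us"]) auto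
qed

lemma derivable_finite:
  assumes "finite S" "\<And>x. x \<in> S \<Longrightarrow> derivable f {x}"
  shows "derivable f S"
  using assms
proof (induction S)
  case empty
  show ?case unfolding derivable_def by (intro exI[of _ 0] exI[of _ "[]"]) simp
next
  case (insert x S)
  then show ?case using derivable_Un[of f "{x}" S] by auto
qed

text \<open>One application of a rule with premises \<open>S\<close>. The prefix length in the last
  hypothesis is chosen freely because the oracle rule needs a prefix reaching its argument; the
  longer of the two prefixes serves both purposes.\<close>

lemma derivable_step:
  assumes "finite S" "\<And>x. x \<in> S \<Longrightarrow> derivable f {x}"
    and "\<And>D. \<forall>x\<in>S. lmem x D \<Longrightarrow> \<exists>k. justified (rprefix f k) D F"
  shows "derivable f {F}"
proof -
  obtain k ts where ts: "derivation (rprefix f k) (list_encode ts)" "S \<subseteq> set ts"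
    using derivable_finite[OF assms(1,2)] by (auto simp: derivable_def)
  then obtain l where "justified (rprefix f l) (list_encode ts) F"
    using assms(3)[of "list_encode ts"] by auto
  then have "justified (rprefix f (max k l)) (list_encode ts) F"
    by (rule justified_mono) auto
  moreover have "derivation (rprefix f (max k l)) (list_encode ts)"
    using ts(1) by (rule derivation_mono) auto
  ultimately have "derivation (rprefix f (max k l)) (list_encode (F # ts))"
    by simp
  then show ?thesis
    unfolding derivable_def by (intro exI[of _ "max k l"] exI[of _ "F # ts"]) auto
qed

lemma derivable_eval: "eval f c xs v \<Longrightarrow> derivable f {fact_code (code c) (list_encode xs) v}"
proof (induction rule: eval.induct)
  case (ev_zero xs)
  show ?case by (rule derivable_step[of "{}"]) (auto simp: justified_def fact_code_def)
next
  case (ev_succ x xs)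
  show ?case
    by (rule derivable_step[of "{}"]) (auto simp: justified_def fact_code_def)
next
  case (ev_proj i xs)
  show ?case by (rule derivable_step[of "{}"]) (use ev_proj in \<open>auto simp: justified_def fact_code_def\<close>)
next
  case (ev_comp ys hs xs g v)
  let ?S = "insert (fact_code (code g) (list_encode ys) v)
      ((\<lambda>i. fact_code (code (hs ! i)) (list_encode xs) (ys ! i)) ` {..<length hs})"
  show ?case
  proof (rule derivable_step[of ?S])
    fix D assume D: "\<forall>x\<in>?S. lmem x D"
    have "justified_comp D (prod_encode (code g, list_encode (map code hs))) (list_encode xs) v"
      unfolding justified_comp_iff using D ev_comp.hyps(1) by (intro exI[of _ "list_encode ys"]) auto
    then show "\<exists>k. justified (rprefix f k) D (fact_code (code (Comp g hs)) (list_encode xs) v)"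
      by (simp add: justified_def fact_code_def)
  qed (use ev_comp.IH in auto)
next
  case (ev_prim0 g xs y h)
  let ?S = "{fact_code (code g) (list_encode xs) y}"
  show ?case
  proof (rule derivable_step[of ?S])
    fix D assume "\<forall>x\<in>?S. lmem x D"
    then have "justified_prim D (code (Prim g h)) (list_encode (0 # xs)) y"
      unfolding justified_prim_iff by auto
    then show "\<exists>k. justified (rprefix f k) D (fact_code (code (Prim g h)) (list_encode (0 # xs)) y)"
      by (simp add: justified_def fact_code_def)
  qed (use ev_prim0.IH in auto)
next
  case (ev_primS g h n xs y z)
  let ?S = "{fact_code (code (Prim g h)) (list_encode (n # xs)) y,
     fact_code (code h) (list_encode (y # n # xs)) z}"
  show ?case
  proof (rule derivable_step[of ?S])
    fix D assume "\<forall>x\<in>?S. lmem x D"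
    then have "justified_prim D (code (Prim g h)) (list_encode (Suc n # xs)) z"
      unfolding justified_prim_iff by auto
    then show "\<exists>k. justified (rprefix f k) D (fact_code (code (Prim g h)) (list_encode (Suc n # xs)) z)"
      by (simp add: justified_def fact_code_def)
  qed (use ev_primS.IH in auto)
next
  case (ev_mu g n xs)
  \<comment> \<open>Fix the positive values refuting the candidates below \<open>n\<close>; together
    with the zero at \<open>n\<close> they are the finitely many premises of the rule.\<close>
  obtain k where k: "\<forall>i<n. k i > 0 \<and> derivable f {fact_code (code g) (list_encode (i # xs)) (k i)}"
    using ev_mu.IH(2) by metis
  let ?S = "insert (fact_code (code g) (list_encode (n # xs)) 0)
      ((\<lambda>i. fact_code (code g) (list_encode (i # xs)) (k i)) ` {..<n})"
  show ?case
  proof (rule derivable_step[of ?S])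
    fix D assume D: "\<forall>x\<in>?S. lmem x D"
    then have "justified_mu D (code g) (list_encode xs) n"
      unfolding justified_mu_iff lcons_list_encode using k by blast
    then show "\<exists>k. justified (rprefix f k) D (fact_code (code (Mu g)) (list_encode xs) n)"
      by (simp add: justified_def fact_code_def)
  qed (use k ev_mu.IH(1) in auto)
next
  case (ev_orc x xs)
  show ?case
  proof (rule derivable_step[of "{}"])
    fix D
    show "\<exists>k. justified (rprefix f k) D (fact_code (code Orc) (list_encode (x # xs)) (f x))"
      by (intro exI[of _ "Suc x"]) (auto simp: justified_def fact_code_def simp del: rprefix_Suc)
  qed auto
qed

text \<open>The use principle: a halting computation consults finitely many oracle values, so it is
  witnessed by a finite prefix and a decidable certificate. The directions are completeness and
  soundness of derivations.\<close>

lemma halts_iff_derives_halt: "halts f c [n] \<longleftrightarrow> (\<exists>k t. derives_halt (code c) n (rprefix f k) t)"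
proof
  assume "halts f c [n]"
  then obtain v where "eval f c [n] v" by (auto simp: halts_def)
  then obtain k ts where ts: "derivation (rprefix f k) (list_encode ts)"
    "fact_code (code c) (list_encode [n]) v \<in> set ts"
    using derivable_eval unfolding derivable_def by blast
  then have "lmem (fact_code (code c) (list_encode [n]) v) (list_encode ts)"
    by simp
  then have "lmem (fact_code (code c) (lcons n 0) v) (list_encode ts)"
    using lcons_list_encode[of n "[]"] by simp
  then show "\<exists>k t. derives_halt (code c) n (rprefix f k) t"
    using ts(1) lmem_fact_bounds unfolding derives_halt_def by blast
next
  assume "\<exists>k t. derives_halt (code c) n (rprefix f k) t"
  then obtain k t v where t: "derivation (rprefix f k) t" "lmem (fact_code (code c) (lcons n 0) v) t"
    by (auto simp: derives_halt_def)
  define ts where "ts = list_decode t"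
  have "t = list_encode ts" by (simp add: ts_def)
  then have "eval f c [n] v"
    using t lcons_list_encode[of n "[]"] by (intro derivation_sound[of f k ts]) auto
  then show "halts f c [n]" by (auto simp: halts_def)
qed

lemma derives_halt_lcons: "derives_halt e n s t \<Longrightarrow> derives_halt e n (lcons a s) t"
  using derivation_mono[of s t "lcons a s"] lookup_lcons unfolding derives_halt_def by blast

lemma derives_halt_rprefix_mono:
  assumes "derives_halt e n (rprefix f k) t" "k \<le> l"
  shows "derives_halt e n (rprefix f l) t"
  using assms(2,1) by (induction rule: dec_induct) (auto intro: derives_halt_lcons)

section \<open>Simulations between trees\<close>

text \<open>A string satisfying this is dead; the remaining strings form the tree of the program,
  whose infinite paths are the oracles on which it diverges. As \<open>t\<close> is unbounded, being
  dead is a semidecidable condition.\<close>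

definition converges :: "nat \<Rightarrow> nat \<Rightarrow> nat \<Rightarrow> bool" where
  "converges e n s \<longleftrightarrow> (\<exists>t. derives_halt e n s t)"

lemma converges_lcons: "converges e n s \<Longrightarrow> converges e n (lcons a s)"
  using derives_halt_lcons unfolding converges_def by blast

lemma halts_iff_converges: "halts f c [n] \<longleftrightarrow> (\<exists>k. converges (code c) n (rprefix f k))"
  by (simp add: halts_iff_derives_halt converges_def)

text \<open>\<open>U\<close> and \<open>V\<close> are the sets of dead strings, so a live
  \<open>\<sigma>\<close> is related only to live strings. A relation replaces the map because it
  can be listed bit by bit; choosing the \<open>b\<close> successively recovers images along a
  path.\<close>

definition simulation :: "(nat \<Rightarrow> nat \<Rightarrow> bool) \<Rightarrow> (nat \<Rightarrow> bool) \<Rightarrow> (nat \<Rightarrow> bool) \<Rightarrow> bool" where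
  "simulation R U V \<longleftrightarrow> R 0 0 \<and>
     (\<forall>\<sigma> \<tau>. R \<sigma> \<tau> \<longrightarrow> (V \<tau> \<longrightarrow> U \<sigma>) \<and> (\<forall>a. \<exists>b. R (lcons a \<sigma>) (lcons b \<tau>)))"

coinductive simulated :: "(nat \<Rightarrow> bool) \<Rightarrow> (nat \<Rightarrow> bool) \<Rightarrow> nat \<Rightarrow> nat \<Rightarrow> bool" for U V where
  "(V \<tau> \<longrightarrow> U \<sigma>) \<Longrightarrow> \<forall>a. \<exists>b. simulated U V (lcons a \<sigma>) (lcons b \<tau>) \<Longrightarrow> simulated U V \<sigma> \<tau>"

lemma simulated_of_dead:
  assumes "U \<sigma>" and U: "\<And>a \<sigma>. U \<sigma> \<Longrightarrow> U (lcons a \<sigma>)"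
  shows "simulated U V \<sigma> \<tau>"
  using assms(1) by (coinduction arbitrary: \<sigma> \<tau>) (auto intro: U)

text \<open>As in the determinacy of a closed game, failure to relate the roots is itself a strategy
  for the opposite direction: unfolding the coinduction at an unrelated pair with
  \<open>\<tau>\<close> live yields a one-step extension of \<open>\<sigma>\<close> that is
  unrelated to every one-step extension of \<open>\<tau>\<close>.\<close>

lemma simulation_total:
  assumes U: "\<And>a \<sigma>. U \<sigma> \<Longrightarrow> U (lcons a \<sigma>)" and V: "\<And>a \<sigma>. V \<sigma> \<Longrightarrow> V (lcons a \<sigma>)"
  shows "(\<exists>R. simulation R U V) \<or> (\<exists>R. simulation R V U)"
proof (cases "simulated U V 0 0")
  case True
  have "simulation (simulated U V) U V"
    unfolding simulation_def using True by (auto elim: simulated.cases)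
  then show ?thesis by blast
next
  case False
  \<comment> \<open>The disjunct \<open>V \<tau>\<close> covers pairs where \<open>\<tau>\<close> is
    already dead: unrelatedness may be lost there, but death persists.\<close>
  define R where "R \<tau> \<sigma> \<longleftrightarrow> \<not> simulated U V \<sigma> \<tau> \<or> V \<tau>" for \<sigma> \<tau>
  have "simulation R V U"
    unfolding simulation_def
  proof (intro conjI allI impI)
    show "R 0 0" using False by (simp add: R_def)
  next
    fix \<tau> \<sigma> assume "R \<tau> \<sigma>" "U \<sigma>"
    then show "V \<tau>" using simulated_of_dead[of U \<sigma> V \<tau>] U by (auto simp: R_def)
  next
    fix \<tau> \<sigma> b assume R: "R \<tau> \<sigma>"
    show "\<exists>a. R (lcons b \<tau>) (lcons a \<sigma>)"
    proof (cases "V \<tau>")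
      case True
      then show ?thesis using V by (auto simp: R_def)
    next
      case False
      then show ?thesis using R simulated.intros[of V \<tau> U \<sigma>] by (auto simp: R_def)
    qed
  qed
  then show ?thesis by blast
qed

lemma simulation_path:
  assumes R: "simulation R U V" and f: "\<And>k. \<not> U (rprefix f k)"
  shows "\<exists>h. \<forall>k. \<not> V (rprefix h k)"
proof -
  \<comment> \<open>The conjunct about \<open>k = 0\<close> carries the starting value through
    dependent choice; it makes the chosen strings prefixes of one \<open>h\<close>.\<close>
  have "\<exists>\<tau>. \<forall>k. (R (rprefix f k) (\<tau> k) \<and> (k = 0 \<longrightarrow> \<tau> k = 0)) \<and> (\<exists>b. \<tau> (Suc k) = lcons b (\<tau> k))"
  proof (rule dependent_nat_choice)
    show "\<exists>\<tau>. R (rprefix f 0) \<tau> \<and> (0 = (0::nat) \<longrightarrow> \<tau> = 0)"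
      using R by (simp add: simulation_def)
    show "\<exists>\<tau>'. (R (rprefix f (Suc k)) \<tau>' \<and> (Suc k = 0 \<longrightarrow> \<tau>' = 0)) \<and> (\<exists>b. \<tau>' = lcons b \<tau>)"
      if "R (rprefix f k) \<tau> \<and> (k = 0 \<longrightarrow> \<tau> = 0)" for \<tau> k
      using R that unfolding simulation_def by (metis nat.distinct(2) rprefix_Suc)
  qed
  then obtain \<tau> where \<tau>: "\<And>k. R (rprefix f k) (\<tau> k)" "\<tau> 0 = 0" "\<And>k. \<exists>b. \<tau> (Suc k) = lcons b (\<tau> k)"
    by blast
  then obtain h where h: "\<And>k. \<tau> (Suc k) = lcons (h k) (\<tau> k)" by metis
  have "\<tau> k = rprefix h k" for k by (induction k) (auto simp: \<tau>(2) h)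
  then show ?thesis using R \<tau>(1) f unfolding simulation_def by metis
qed

text \<open>An oracle on which \<open>c\<close> diverges is a path through its tree; the simulation
  would turn it into a path through the tree of \<open>d\<close>, which has none.\<close>

lemma simulation_halts:
  assumes "simulation R (converges (code c) n) (converges (code d) n)" "\<And>f. halts f d [n]"
  shows "halts f c [n]"
  using simulation_path[OF assms(1), of f] assms(2) by (auto simp: halts_iff_converges)

text \<open>A point of Cantor space carries, on the multiples of \<open>m\<close>, for every pair of programs \<open>c\<close>, \<open>d\<close>
  and every input \<open>n\<close> a simulation between the trees of oracle strings on which \<open>c\<close>,
  respectively \<open>d\<close>, has not halted, and one bit telling which tree is simulated by the other.\<close>

definition choice_pos :: "nat \<Rightarrow> nat \<Rightarrow> nat \<Rightarrow> nat \<Rightarrow> nat" where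
  "choice_pos m c d n = m * prod_encode (prod_encode (c, prod_encode (d, n)), 0)"

text \<open>\<open>Suc\<close> keeps these positions apart from the choice bit, which has second
  component 0.\<close>

definition simulation_pos :: "nat \<Rightarrow> nat \<Rightarrow> nat \<Rightarrow> nat \<Rightarrow> nat \<Rightarrow> nat \<Rightarrow> nat" where
  "simulation_pos m c d n \<sigma> \<tau> =
     m * prod_encode (prod_encode (c, prod_encode (d, n)), Suc (prod_encode (\<sigma>, \<tau>)))"

definition comparison_class :: "nat \<Rightarrow> (nat \<Rightarrow> bool) set" where
  "comparison_class m = {y. \<forall>c d n.
     let b = y (choice_pos m c d n) in
     simulation (\<lambda>\<sigma> \<tau>. y (simulation_pos m c d n \<sigma> \<tau>))
       (converges (if b then c else d) n) (converges (if b then d else c) n)}"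

text \<open>A wrong bit would carry halting for all oracles over to the other program: if the bit is
  \<open>True\<close> although \<open>n\<close> is not in \<open>H\<close>, then \<open>d\<close>
  halts for all oracles, hence so does \<open>c\<close>, and \<open>n\<close> is in \<open>H\<close>
  after all. The other case is symmetric.\<close>

lemma comparison_class_choice:
  assumes "y \<in> comparison_class m"
    and "\<And>n. n \<in> H \<longleftrightarrow> (\<forall>f. halts f c [n])" "\<And>n. n \<in> - H \<longleftrightarrow> (\<forall>f. halts f d [n])"
  shows "y (choice_pos m (code c) (code d) n) \<longleftrightarrow> n \<in> H"
proof -
  have *: "simulation (\<lambda>\<sigma> \<tau>. y (simulation_pos m c d n \<sigma> \<tau>))
      (converges (if y (choice_pos m c d n) then c else d) n)
      (converges (if y (choice_pos m c d n) then d else c) n)" for c d n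
    using assms(1) by (simp add: comparison_class_def Let_def)
  show ?thesis
  proof (cases "y (choice_pos m (code c) (code d) n)")
    case True
    then have "simulation (\<lambda>\<sigma> \<tau>. y (simulation_pos m (code c) (code d) n \<sigma> \<tau>))
        (converges (code c) n) (converges (code d) n)"
      using *[of "code c" "code d" n] by simp
    then show ?thesis using simulation_halts assms(2,3)[of n] True by blast
  next
    case False
    then have "simulation (\<lambda>\<sigma> \<tau>. y (simulation_pos m (code c) (code d) n \<sigma> \<tau>))
        (converges (code d) n) (converges (code c) n)"
      using *[of "code c" "code d" n] by simp
    then show ?thesis using simulation_halts assms(2,3)[of n] False by blast
  qed
qed

text \<open>A direction and a simulation are chosen for every triple at once; numbers coding no
  program are covered too, as the choice rests on the persistence of convergence alone. All
  positions off the multiples of \<open>m\<close> stay free.\<close>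

lemma comparison_class_inhabited:
  assumes "m > 0"
  shows "\<exists>z. \<forall>y. (\<forall>p. y (m * p) = z p) \<longrightarrow> y \<in> comparison_class m"
proof -
  have "\<exists>b R. simulation R (converges (if b then c else d) n) (converges (if b then d else c) n)" for c d n
    using simulation_total[of "converges c n" "converges d n"] converges_lcons by (metis (full_types))
  then obtain B R where BR: "\<And>c d n. simulation (R c d n)
      (converges (if B c d n then c else d) n) (converges (if B c d n then d else c) n)"
    by metis
  define z where "z p = (let c = pfst (pfst p); d = pfst (psnd (pfst p)); n = psnd (psnd (pfst p));
      r = psnd p in if r = 0 then B c d n else R c d n (pfst (r - 1)) (psnd (r - 1)))" for p
  have "y \<in> comparison_class m" if "\<forall>p. y (m * p) = z p" for y
    using BR that by (simp add: comparison_class_def choice_pos_def simulation_pos_def z_def)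
  then show ?thesis by blast
qed

section \<open>Arithmetical complexity of the class\<close>

definition comparison_step ::
    "nat \<Rightarrow> (nat \<Rightarrow> nat) \<Rightarrow> nat \<Rightarrow> nat \<Rightarrow> nat \<Rightarrow> nat \<Rightarrow> nat \<Rightarrow> nat \<Rightarrow> nat \<Rightarrow> nat \<Rightarrow> nat \<Rightarrow> bool" where
  "comparison_step m f c d n \<sigma> \<tau> a t b t' \<longleftrightarrow>
     f (simulation_pos m c d n 0 0) = 1 \<and>
     (f (simulation_pos m c d n \<sigma> \<tau>) = 1 \<longrightarrow>
       (derives_halt (if f (choice_pos m c d n) = 1 then d else c) n \<tau> t \<longrightarrow>
        derives_halt (if f (choice_pos m c d n) = 1 then c else d) n \<sigma> t') \<and>
       f (simulation_pos m c d n (lcons a \<sigma>) (lcons b \<tau>)) = 1)"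

text \<open>Prenex form. A certificate \<open>t\<close> for the hypothesis \<open>V \<tau>\<close>
  becomes universal, a certificate \<open>t'\<close> for the conclusion existential;
  \<open>b\<close> and \<open>t'\<close> occur in separate conjuncts, so their choices do not
  interfere.\<close>

lemma comparison_class_iff:
  "y \<in> comparison_class m \<longleftrightarrow>
     (\<forall>c d n \<sigma> \<tau> a t. \<exists>b t'. comparison_step m (chi y) c d n \<sigma> \<tau> a t b t')"
proof -
  have chi: "chi y k = 1 \<longleftrightarrow> y k" for k by (simp add: chi_def)
  have ite: "converges (if b then c else d) n s \<longleftrightarrow> (\<exists>t. derives_halt (if b then c else d) n s t)" for b c d n s
    by (simp add: converges_def)
  show ?thesis
    unfolding comparison_class_def comparison_step_def simulation_def Let_def mem_Collect_eq chi ite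
    by blast
qed

lemma pi02_class_comparison_class: "pi02_class (comparison_class m)"
proof -
  \<comment> \<open>\<open>N\<close> packs the seven universal variables into one list code, and
    \<open>i\<close> the two witnesses; the program searches for \<open>i\<close> on input
    \<open>N\<close>.\<close>
  define Q where "Q f N i \<longleftrightarrow> comparison_step m f (lnth N 0) (lnth N 1) (lnth N 2) (lnth N 3)
     (lnth N 4) (lnth N 5) (lnth N 6) (lnth i 0) (lnth i 1)" for f N i
  have "decidable (Suc 1) (\<lambda>f xs. Q f (hd (tl xs)) (hd xs))"
    unfolding Q_def comparison_step_def choice_pos_def simulation_pos_def
    by (intro computable_intros) simp_all
  from ex_halts_iff_ex[OF this] obtain c where
    c: "\<And>f xs. length xs = 1 \<Longrightarrow> halts f c xs \<longleftrightarrow> (\<exists>i. Q f (hd xs) i)" by blast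
  have c': "halts f c [n] \<longleftrightarrow> (\<exists>i. Q f n i)" for f n using c[of "[n]" f] by simp
  have "y \<in> comparison_class m \<longleftrightarrow> (\<forall>N. \<exists>i. Q (chi y) N i)" for y
  proof
    assume y: "y \<in> comparison_class m"
    show "\<forall>N. \<exists>i. Q (chi y) N i"
    proof
      fix N
      obtain b t' where "comparison_step m (chi y) (lnth N 0) (lnth N 1) (lnth N 2) (lnth N 3)
          (lnth N 4) (lnth N 5) (lnth N 6) b t'"
        using y unfolding comparison_class_iff by blast
      then have "Q (chi y) N (list_encode [b, t'])" by (simp add: Q_def)
      then show "\<exists>i. Q (chi y) N i" ..
    qed
  next
    assume Q: "\<forall>N. \<exists>i. Q (chi y) N i"
    show "y \<in> comparison_class m"
      unfolding comparison_class_iff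
    proof (intro allI)
      fix c d n \<sigma> \<tau> a t
      obtain i where "Q (chi y) (list_encode [c, d, n, \<sigma>, \<tau>, a, t]) i" using Q by blast
      then have "comparison_step m (chi y) c d n \<sigma> \<tau> a t (lnth i 0) (lnth i 1)" by (simp add: Q_def)
      then show "\<exists>b t'. comparison_step m (chi y) c d n \<sigma> \<tau> a t b t'" by blast
    qed
  qed
  then show ?thesis unfolding pi02_class_def c'[symmetric] by blast
qed

section \<open>Compactness\<close>

text \<open>Konig's lemma: bits are fixed one after another, each with a value keeping infinitely
  many of the points in agreement.\<close>

lemma cantor_limit_point:
  fixes Y :: "nat \<Rightarrow> nat \<Rightarrow> bool"
  shows "\<exists>y. \<forall>k. infinite {N. \<forall>i<k. Y N i = y i}"
proof -
  have "\<exists>g. \<forall>k. infinite {N. \<forall>i<k. Y N i = g k i} \<and> (\<forall>i<k. g (Suc k) i = g k i)"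
  proof (rule dependent_nat_choice)
    show "\<exists>x. infinite {N. \<forall>i<0. Y N i = x i}" by simp
  next
    fix g :: "nat \<Rightarrow> bool" and k assume inf: "infinite {N. \<forall>i<k. Y N i = g i}"
    have "{N. \<forall>i<k. Y N i = g i} \<subseteq>
        {N. \<forall>i<Suc k. Y N i = (g(k := True)) i} \<union> {N. \<forall>i<Suc k. Y N i = (g(k := False)) i}"
      by (auto simp: less_Suc_eq)
    then have "infinite {N. \<forall>i<Suc k. Y N i = (g(k := True)) i} \<or>
        infinite {N. \<forall>i<Suc k. Y N i = (g(k := False)) i}"
      using inf finite_subset by blast
    then show "\<exists>g'. infinite {N. \<forall>i<Suc k. Y N i = g' i} \<and> (\<forall>i<k. g' i = g i)"
    proof
      assume "infinite {N. \<forall>i<Suc k. Y N i = (g(k := True)) i}"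
      then show ?thesis by (intro exI[of _ "g(k := True)"]) auto
    next
      assume "infinite {N. \<forall>i<Suc k. Y N i = (g(k := False)) i}"
      then show ?thesis by (intro exI[of _ "g(k := False)"]) auto
    qed
  qed
  then obtain g where g: "\<And>k. infinite {N. \<forall>i<k. Y N i = g k i}" "\<And>k i. i < k \<Longrightarrow> g (Suc k) i = g k i"
    by blast
  define y where "y i = g (Suc i) i" for i
  have "g k i = y i" if "Suc i \<le> k" for i k
    using that by (induction rule: dec_induct) (auto simp: y_def g(2))
  then have "{N. \<forall>i<k. Y N i = g k i} = {N. \<forall>i<k. Y N i = y i}" for k
    by (simp add: Suc_le_eq)
  then show ?thesis using g(1) by (intro exI[of _ y]) metis
qed

lemma prod_encode_mono: "a \<le> a' \<Longrightarrow> b \<le> b' \<Longrightarrow> prod_encode (a, b) \<le> prod_encode (a', b')"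
proof -
  assume *: "a \<le> a'" "b \<le> b'"
  have "triangle i \<le> triangle j" if "i \<le> j" for i j
    using that by (induction rule: dec_induct) auto
  from this[of "a + b" "a' + b'"] show ?thesis using * by (simp add: prod_encode_def)
qed

text \<open>Bounds the code of every 0-1 string of length \<open>k\<close> by that of the all-ones
  string, so that quantifying over such strings is a bounded search.\<close>

lemma rprefix_mono: "(\<And>i. f i \<le> g i) \<Longrightarrow> rprefix f k \<le> rprefix g k"
  by (induction k) (auto simp: lcons_def intro!: prod_encode_mono)

lemma rprefix_cong: "(\<And>i. i < k \<Longrightarrow> f i = g i) \<Longrightarrow> rprefix f k = rprefix g k"
  unfolding rprefix_def by (intro arg_cong[of _ _ list_encode] arg_cong[of _ _ rev] map_cong) auto

lemma llen_rprefix [simp]: "llen (rprefix f k) = k"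
  by (simp add: rprefix_def)

lemma ex_rprefix_eq: "\<exists>f. s = rprefix f (llen s)"
proof -
  define xs where "xs = list_decode s"
  have s: "s = list_encode xs" by (simp add: xs_def)
  have "map (\<lambda>i. rev xs ! i) [0..<length xs] = rev xs"
    using map_nth[of "rev xs"] by simp
  then have "s = rprefix (\<lambda>i. rev xs ! i) (llen s)" by (simp add: s rprefix_def)
  then show ?thesis by blast
qed

text \<open>By stage \<open>N\<close> it is visible that program \<open>e\<close> halts for all oracles joining \<open>f\<close> and \<open>y\<close> with \<open>y p = v\<close>.\<close>

definition excluded :: "nat \<Rightarrow> (nat \<Rightarrow> nat) \<Rightarrow> nat \<Rightarrow> nat \<Rightarrow> nat \<Rightarrow> bool" where
  "excluded e f v N p \<longleftrightarrow> 2 * p + 1 < N \<and>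
     (\<forall>s<Suc (rprefix (\<lambda>_. 1) N).
        llen s = N \<and> (\<forall>i<N. 2 * i < N \<longrightarrow> lookup s (2 * i) (f i)) \<and>
        (\<forall>i<N. \<exists>b<2. lookup s i b) \<and> lookup s (2 * p + 1) v \<longrightarrow>
        (\<exists>t<N. derives_halt e 0 s t))"

lemma decidable_excluded [computable_intros]:
  assumes "computable m A" "computable m B"
  shows "decidable m (\<lambda>f xs. excluded e f v (A f xs) (B f xs))"
proof (rule decidable_comp2[OF _ assms])
  have "rprefix (\<lambda>_. 1) N = rec_nat 0 (\<lambda>_ l. lcons 1 l) N" for N by (induction N) auto
  then show "decidable 2 (\<lambda>f xs. excluded e f v (hd xs) (hd (tl xs)))"
    unfolding excluded_def by (simp only:) (intro computable_intros; simp)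
qed

lemma excluded_sound:
  assumes "excluded (code c) (chi x) v N p" "chi y p = v"
  shows "halts (chi (Defs.join x y)) c [0]"
proof -
  let ?s = "rprefix (chi (Defs.join x y)) N"
  have "?s < Suc (rprefix (\<lambda>_. 1) N)"
    by (auto simp: less_Suc_eq_le chi_def intro: rprefix_mono)
  moreover have "\<forall>i<N. 2 * i < N \<longrightarrow> lookup ?s (2 * i) (chi x i)"
    by (auto simp: chi_def Defs.join_def)
  moreover have "\<forall>i<N. \<exists>b<2. lookup ?s i b" by (auto simp: chi_def)
  moreover have "lookup ?s (2 * p + 1) v"
    using assms by (auto simp: excluded_def chi_def Defs.join_def)
  ultimately obtain t where "derives_halt (code c) 0 ?s t"
    using assms(1) unfolding excluded_def by (metis llen_rprefix)
  then show ?thesis by (auto simp: halts_iff_derives_halt)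
qed

text \<open>Compactness. If no stage sufficed, every late stage would have a counterexample; a limit
  point of these still takes the value \<open>v\<close> at \<open>p\<close>, so its computation
  halts within a finite prefix, which a late counterexample shares.\<close>

lemma excluded_complete:
  assumes halts: "\<And>y. chi y p = v \<Longrightarrow> halts (chi (Defs.join x y)) c [0]"
  shows "\<exists>N. excluded (code c) (chi x) v N p"
proof (rule ccontr)
  assume *: "\<nexists>N. excluded (code c) (chi x) v N p"
  define bad where "bad y N \<longleftrightarrow> chi y p = v \<and>
      (\<forall>t<N. \<not> derives_halt (code c) 0 (rprefix (chi (Defs.join x y)) N) t)" for y N
  have "\<exists>y. 2 * p + 1 < N \<longrightarrow> bad y N" for N
  proof (cases "2 * p + 1 < N")
    case True
    have "\<not> excluded (code c) (chi x) v N p" using * by simp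
    with True obtain s where s: "llen s = N" "\<forall>i<N. 2 * i < N \<longrightarrow> lookup s (2 * i) (chi x i)"
      "\<forall>i<N. \<exists>b<2. lookup s i b" "lookup s (2 * p + 1) v" "\<forall>t<N. \<not> derives_halt (code c) 0 s t"
      unfolding excluded_def by metis
    obtain F where F: "s = rprefix F N" using ex_rprefix_eq[of s] s(1) by auto
    \<comment> \<open>Odd positions of the join hold \<open>y\<close>; only values below
      \<open>N\<close> are compared, so the bits beyond are arbitrary.\<close>
    define y where "y i \<longleftrightarrow> F (2 * i + 1) = 1" for i
    have F2: "F i < 2" if "i < N" for i using s(3) that by (auto simp: F)
    have "F i = chi (Defs.join x y) i" if "i < N" for i
    proof (cases "even i")
      case True
      then show ?thesis using s(2) that by (auto simp: F chi_def Defs.join_def elim!: evenE)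
    next
      case False
      then show ?thesis using F2[OF that] that by (auto simp: chi_def Defs.join_def y_def elim!: oddE)
    qed
    then have "s = rprefix (chi (Defs.join x y)) N" unfolding F by (rule rprefix_cong)
    moreover have "chi y p = v"
      using s(4) F2[OF True] by (auto simp: F chi_def y_def)
    ultimately show ?thesis using s(5) unfolding bad_def by blast
  qed simp
  then have "\<exists>Y. \<forall>N. 2 * p + 1 < N \<longrightarrow> bad (Y N) N" by (intro choice) blast
  then obtain Y where Y: "\<And>N. 2 * p + 1 < N \<Longrightarrow> chi (Y N) p = v"
    "\<And>N t. 2 * p + 1 < N \<Longrightarrow> t < N \<Longrightarrow> \<not> derives_halt (code c) 0 (rprefix (chi (Defs.join x (Y N))) N) t"
    unfolding bad_def by blast
  obtain y where y: "\<And>k. infinite {N. \<forall>i<k. Y N i = y i}" using cantor_limit_point by blast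
  have large: "\<exists>N>l. \<forall>i<k. Y N i = y i" for k l
    using y[of k] infinite_nat_iff_unbounded by auto
  obtain N where "N > 2 * p + 1" "Y N p = y p" using large[of "2 * p + 1" "Suc p"] by auto
  then have "chi y p = v" using Y(1)[of N] by (simp add: chi_def)
  then obtain k t where kt: "derives_halt (code c) 0 (rprefix (chi (Defs.join x y)) k) t"
    using halts unfolding halts_iff_derives_halt by blast
  \<comment> \<open>\<open>N\<close> also exceeds \<open>k\<close> and \<open>t\<close>: the prefix
    then extends the halting one, and the certificate counts at stage \<open>N\<close>.\<close>
  obtain N where N: "N > 2 * p + 1 + k + t" "\<And>i. i < k \<Longrightarrow> Y N i = y i"
    using large[of "2 * p + 1 + k + t" k] by auto
  have "rprefix (chi (Defs.join x (Y N))) k = rprefix (chi (Defs.join x y)) k"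
    using N(2) by (intro rprefix_cong) (auto simp: chi_def Defs.join_def)
  then have "derives_halt (code c) 0 (rprefix (chi (Defs.join x (Y N))) N) t"
    using kt N(1) derives_halt_rprefix_mono[of "code c" 0 "chi (Defs.join x (Y N))" k t N] by simp
  then show False using Y(2)[of N t] N(1) by simp
qed

text \<open>The value that the members of \<open>P\<close> share is never excluded, since a member
  realises it; the other value is realised by no member and is excluded at some stage. With oracle
  \<open>x\<close>, the search waits until 0 or 1 is excluded.\<close>

lemma turing_le_of_constant_bits:
  assumes P: "pi01_class_rel x P" "P \<noteq> {}"
    and p: "computable 1 (\<lambda>f xs. p (hd xs))"
    and H: "\<And>y n. y \<in> P \<Longrightarrow> y (p n) \<longleftrightarrow> n \<in> H"
  shows "turing_le (\<lambda>n. n \<in> H) x"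
proof -
  obtain c where c: "\<And>y. y \<in> P \<longleftrightarrow> \<not> halts (chi (Defs.join x y)) c [0]"
    using P(1) by (auto simp: pi01_class_rel_def)
  obtain y where y: "y \<in> P" using P(2) by blast
  have ex: "(\<exists>N. excluded (code c) (chi x) v N (p n)) \<longleftrightarrow> v \<noteq> of_bool (n \<in> H)" for v n
  proof
    assume "\<exists>N. excluded (code c) (chi x) v N (p n)"
    then have "chi y (p n) \<noteq> v" using excluded_sound[of c x v _ "p n" y] c y by blast
    then show "v \<noteq> of_bool (n \<in> H)" using H[OF y, of n] by (auto simp: chi_def)
  next
    assume v: "v \<noteq> of_bool (n \<in> H)"
    show "\<exists>N. excluded (code c) (chi x) v N (p n)"
    proof (rule excluded_complete)
      fix y assume "chi y (p n) = v"
      then show "halts (chi (Defs.join x y)) c [0]"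
        using v c[of y] H[of y n] by (cases "y \<in> P") (auto simp: chi_def)
    qed
  qed
  have p': "computable m (\<lambda>f xs. p (A f xs))" if "computable m A" for m A
    by (rule computable_comp1[OF p that])
  have "\<exists>e. \<forall>f xs. length xs = 1 \<longrightarrow>
      (\<exists>N. excluded (code c) f 0 N (p (hd xs)) \<or> excluded (code c) f 1 N (p (hd xs))) \<longrightarrow>
      eval f e xs (of_bool (excluded (code c) f 0
        (LEAST N. excluded (code c) f 0 N (p (hd xs)) \<or> excluded (code c) f 1 N (p (hd xs))) (p (hd xs))))"
  proof (rule ex_eval_Least)
    show "decidable (Suc 1) (\<lambda>f xs. excluded (code c) f 0 (hd xs) (p (hd (tl xs))) \<or>
        excluded (code c) f 1 (hd xs) (p (hd (tl xs))))"
      by (intro computable_intros p') simp_all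
    have "decidable (Suc 1) (\<lambda>f xs. excluded (code c) f 0 (hd xs) (p (hd (tl xs))))"
      by (intro computable_intros p') simp_all
    then show "computable (Suc 1) (\<lambda>f xs. of_bool (excluded (code c) f 0 (hd xs) (p (hd (tl xs)))))"
      by (simp add: decidable_def)
  qed
  then obtain e where e: "\<And>f xs. length xs = 1 \<Longrightarrow>
      \<exists>N. excluded (code c) f 0 N (p (hd xs)) \<or> excluded (code c) f 1 N (p (hd xs)) \<Longrightarrow>
      eval f e xs (of_bool (excluded (code c) f 0
        (LEAST N. excluded (code c) f 0 N (p (hd xs)) \<or> excluded (code c) f 1 N (p (hd xs))) (p (hd xs))))"
    by blast
  have "eval (chi x) e [n] (if n \<in> H then 1 else 0)" for n
  proof -
    let ?L = "LEAST N. excluded (code c) (chi x) 0 N (p n) \<or> excluded (code c) (chi x) 1 N (p n)"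
    have some: "\<exists>N. excluded (code c) (chi x) 0 N (p n) \<or> excluded (code c) (chi x) 1 N (p n)"
      using ex[of 0 n] ex[of 1 n] by (cases "n \<in> H") auto
    have "excluded (code c) (chi x) 0 ?L (p n) \<or> excluded (code c) (chi x) 1 ?L (p n)"
      using LeastI_ex[OF some] .
    then have "excluded (code c) (chi x) 0 ?L (p n) \<longleftrightarrow> n \<in> H"
      using ex[of 0 n] ex[of 1 n] by (cases "n \<in> H") auto
    then show ?thesis using e[of "[n]" "chi x"] some by (cases "n \<in> H") simp_all
  qed
  then show ?thesis unfolding turing_le_def by blast
qed

lemma hyperarithmetic_turing_le:
  assumes "pi01_class_rel x P" "P \<noteq> {}" "P \<subseteq> comparison_class m" "hyperarithmetic H"
  shows "turing_le (\<lambda>n. n \<in> H) x"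
proof -
  obtain c d where cd: "\<And>n. n \<in> H \<longleftrightarrow> (\<forall>f. halts f c [n])" "\<And>n. n \<in> - H \<longleftrightarrow> (\<forall>f. halts f d [n])"
    using assms(4) unfolding hyperarithmetic_def pi11_def by blast
  show ?thesis
  proof (rule turing_le_of_constant_bits[OF assms(1,2)])
    show "computable 1 (\<lambda>f xs. choice_pos m (code c) (code d) (hd xs))"
      unfolding choice_pos_def by (intro computable_intros) simp_all
    show "y (choice_pos m (code c) (code d) n) \<longleftrightarrow> n \<in> H" if "y \<in> P" for y n
      using comparison_class_choice[OF _ cd] that assms(3) by blast
  qed
qed

section \<open>Mass distribution\<close>

lemma cdist_le_cdiam:
  assumes "x \<in> U" "y \<in> U"
  shows "cdist x y \<le> cdiam U"
proof -
  have "2 powr - real n \<le> 1" for n by (simp add: powr_minus powr_realpow divide_simps)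
  then have "bdd_above ((\<lambda>p. cdist (fst p) (snd p)) ` (U \<times> U))"
    by (intro bdd_aboveI[of _ 1]) (auto simp: cdist_def)
  then have "cdist (fst (x, y)) (snd (x, y)) \<le> (SUP p\<in>U \<times> U. cdist (fst p) (snd p))"
    using assms by (intro cSUP_upper) auto
  then show ?thesis using assms by (auto simp: cdiam_def)
qed

lemma hausdorff_pos_of_covers:
  assumes "c > 0" "\<And>U. A \<subseteq> (\<Union>i. U i) \<Longrightarrow> c \<le> (\<Sum>i. ennreal (cdiam (U i) powr s))"
  shows "hausdorff s A > 0"
proof -
  have "c \<le> hausdorff_approx s 1 A"
    unfolding hausdorff_approx_def by (rule INF_greatest) (use assms(2) in auto)
  also have "\<dots> \<le> hausdorff s A"
    unfolding hausdorff_def by (rule SUP_upper) simp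
  finally show ?thesis using assms(1) by simp
qed

lemma hausdorff_empty: "hausdorff s {} = 0"
proof -
  have "hausdorff_approx s \<delta> {} \<le> 0" if "\<delta> > 0" for \<delta>
    unfolding hausdorff_approx_def
    by (rule INF_lower2[of "\<lambda>_. {}"]) (use that in \<open>auto simp: cdiam_def\<close>)
  then show ?thesis unfolding hausdorff_def by (auto intro!: antisym SUP_least)
qed

text \<open>There are at most \<open>n / m + 1\<close> multiples of \<open>m\<close> below
  \<open>n\<close>, so the others have density at least \<open>s\<close>; the loss of 1 becomes the
  factor 2 in the mass estimate.\<close>

lemma card_nonmultiples:
  assumes "m > 0" "1 / real m \<le> 1 - s"
  shows "s * real n - 1 \<le> real (card {k. k < n \<and> \<not> m dvd k})"
proof -
  have "{k. k < n \<and> m dvd k} \<subseteq> (\<lambda>j. m * j) ` {..n div m}"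
    by (auto elim!: dvdE simp: assms(1) intro!: imageI) (simp add: assms(1) less_eq_div_iff_mult_less_eq mult.commute)
  then have "card {k. k < n \<and> m dvd k} \<le> n div m + 1"
    using surj_card_le[of "{..n div m}" "{k. k < n \<and> m dvd k}" "\<lambda>j. m * j"] by simp
  moreover have "real (n div m) \<le> real n * (1 / real m)"
    using of_nat_div_le_of_nat[of n m, where ?'a = real] by simp
  moreover have "real n * (1 / real m) \<le> real n * (1 - s)"
    using assms(2) by (intro mult_left_mono) auto
  moreover have "card {k. k < n \<and> m dvd k} + card {k. k < n \<and> \<not> m dvd k} = n"
  proof -
    have "card {k. k < n \<and> m dvd k} + card {k. k < n \<and> \<not> m dvd k} =
        card ({k. k < n \<and> m dvd k} \<union> {k. k < n \<and> \<not> m dvd k})"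
      by (rule card_Un_disjoint[symmetric]) auto
    also have "{k. k < n \<and> m dvd k} \<union> {k. k < n \<and> \<not> m dvd k} = {..<n}" by auto
    finally show ?thesis by simp
  qed
  ultimately show ?thesis by (simp add: algebra_simps)
qed

section \<open>Fair coins and the mass of covering sets\<close>

definition coins :: "(nat \<Rightarrow> bool) measure" where
  "coins = PiM UNIV (\<lambda>_. measure_pmf (pmf_of_set UNIV))"

interpretation coins: product_prob_space "\<lambda>_::nat. measure_pmf (pmf_of_set (UNIV::bool set))" UNIV
  by unfold_locales

lemma space_coins [simp]: "space coins = UNIV"
  by (simp add: coins_def space_PiM)

lemma prob_space_coins: "prob_space coins"
  unfolding coins_def by (rule prob_space_PiM) unfold_locales

lemma measure_coins_cylinder:
  assumes "finite J"
  shows "{w. \<forall>k\<in>J. w k = u k} \<in> sets coins" "measure coins {w. \<forall>k\<in>J. w k = u k} = (1/2) ^ card J"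
proof -
  have eq: "{w. \<forall>k\<in>J. w k = u k} = {w \<in> space coins. \<forall>k\<in>J. w k \<in> {u k}}" by simp
  show "{w. \<forall>k\<in>J. w k = u k} \<in> sets coins"
    unfolding eq coins_def
    by (intro sets.sets_Collect_finite_All[OF _ assms] sets_Collect_single') auto
  have "emeasure coins {w. \<forall>k\<in>J. w k = u k} =
      (\<Prod>k\<in>J. emeasure (measure_pmf (pmf_of_set (UNIV::bool set))) {u k})"
    unfolding eq coins_def using assms by (intro coins.emeasure_PiM_Collect) auto
  also have "\<dots> = (\<Prod>k\<in>J. ennreal (1/2))"
    by (simp add: emeasure_pmf_single)
  also have "\<dots> = ennreal ((1/2) ^ card J)"
    by (simp only: prod_constant ennreal_power)
  finally show "measure coins {w. \<forall>k\<in>J. w k = u k} = (1/2) ^ card J"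
    by (simp add: measure_def)
qed

text \<open>If the members of \<open>U\<close> agree below \<open>n\<close>, then
  \<open>Y w \<in> U\<close> fixes \<open>w\<close> at no fewer than \<open>s * n - 1\<close>
  positions, an event of probability at most twice the \<open>s\<close>-th power of
  \<open>2 powr - n\<close>. The superset \<open>E\<close> is there because
  \<open>{w. Y w \<in> U}\<close> may fail to be measurable for arbitrary \<open>U\<close>.\<close>

lemma coins_cover:
  assumes m: "m > 0" "1 / real m \<le> 1 - s" and s: "0 < s"
    and Y: "\<And>w k. \<not> m dvd k \<Longrightarrow> Y w k = w k"
  shows "\<exists>E\<in>sets coins. {w. Y w \<in> U} \<subseteq> E \<and> measure coins E \<le> 2 * cdiam U powr s"
proof (cases "U = {}")
  case True
  then show ?thesis by (intro bexI[of _ "{}"]) auto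
next
  case False
  then obtain u where u: "u \<in> U" by blast
  define J where "J n = {k. k < n \<and> \<not> m dvd k}" for n
  define C where "C n = {w. \<forall>k\<in>J n. w k = u k}" for n
  have C: "C n \<in> sets coins" and measure_C: "measure coins (C n) = (1/2) ^ card (J n)" for n
    unfolding C_def J_def by (intro measure_coins_cylinder; simp)+
  have C_le: "measure coins (C n) \<le> 2 * (2 powr - real n) powr s" for n
  proof -
    have "measure coins (C n) = 2 powr - real (card (J n))"
      by (simp add: measure_C powr_minus powr_realpow power_one_over divide_simps)
    also have "\<dots> \<le> 2 powr (1 + - real n * s)"
      using card_nonmultiples[OF m, of n] by (intro powr_mono) (auto simp: J_def algebra_simps)
    also have "\<dots> = 2 * (2 powr - real n) powr s"
      by (simp only: powr_add powr_powr) simp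
    finally show ?thesis .
  qed
  \<comment> \<open>A single point has diameter 0 and needs a null set: the intersection of all
    cylinders around it. Otherwise the first place of disagreement bounds the diameter from
    below.\<close>
  show ?thesis
  proof (cases "U = {u}")
    case True
    interpret prob_space coins by (rule prob_space_coins)
    define E where "E = (\<Inter>n. C n)"
    have E: "E \<in> sets coins" unfolding E_def using C by auto
    have "measure coins E \<le> 2 * (2 powr - s) ^ n" for n
    proof -
      have "measure coins E \<le> measure coins (C n)"
        using C by (intro finite_measure_mono) (auto simp: E_def)
      also have "\<dots> \<le> 2 * (2 powr - s) ^ n"
        using C_le[of n] by (simp add: powr_powr powr_realpow[symmetric] mult.commute)
      finally show ?thesis .
    qed
    moreover have "(\<lambda>n. 2 * (2 powr - s) ^ n) \<longlonglongrightarrow> 2 * 0"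
      using s by (intro tendsto_mult tendsto_const LIMSEQ_realpow_zero) (auto simp: powr_minus divide_simps)
    ultimately have "measure coins E \<le> 0"
      using LIMSEQ_le_const[of "\<lambda>n. 2 * (2 powr - s) ^ n" 0 "measure coins E"] by simp
    moreover have "{w. Y w \<in> U} \<subseteq> E"
      using True Y by (auto simp: E_def C_def J_def)
    ultimately show ?thesis using E by (intro bexI[of _ E]) (auto intro: order_trans)
  next
    case False
    define D where "D = {n. \<exists>v\<in>U. v n \<noteq> u n}"
    obtain v where "v \<in> U" "v \<noteq> u" using False u by blast
    then obtain k where "v k \<noteq> u k" by blast
    then have "k \<in> D" using \<open>v \<in> U\<close> by (auto simp: D_def)
    define n where "n = (LEAST n. n \<in> D)"
    have "n \<in> D" unfolding n_def using \<open>k \<in> D\<close> by (rule LeastI)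
    have before: "v i = u i" if "i < n" "v \<in> U" for v i
      using not_less_Least[of i "\<lambda>n. n \<in> D"] that by (auto simp: n_def D_def)
    obtain v where v: "v \<in> U" "v n \<noteq> u n" using \<open>n \<in> D\<close> by (auto simp: D_def)
    have least: "(LEAST i. v i \<noteq> u i) = n"
      using v before by (intro Least_equality) (auto simp: not_less[symmetric])
    have "v \<noteq> u" using v(2) by auto
    then have "cdist v u = 2 powr - real n" unfolding cdist_def least[symmetric] by simp
    then have "2 powr - real n \<le> cdiam U" using cdist_le_cdiam[OF v(1) u] by simp
    then have "(2 powr - real n) powr s \<le> cdiam U powr s"
      using s by (intro powr_mono2) auto
    then have "measure coins (C n) \<le> 2 * cdiam U powr s" using C_le[of n] by simp
    moreover have "{w. Y w \<in> U} \<subseteq> C n"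
      using before Y by (auto simp: C_def J_def)
    ultimately show ?thesis using C by blast
  qed
qed

text \<open>Mass distribution principle for the fair coins pushed into \<open>A\<close>: every cover
  has total mass at least 1, and each member \<open>U i\<close> carries at most
  \<open>2 * cdiam (U i) powr s\<close>.\<close>

lemma hausdorff_pos_of_free_bits:
  assumes m: "m > 0" "1 / real m \<le> 1 - s" and s: "0 < s"
    and A: "\<And>y. (\<And>p. y (m * p) = z p) \<Longrightarrow> y \<in> A"
  shows "hausdorff s A > 0"
proof (rule hausdorff_pos_of_covers[where c = "ennreal (1/2)"])
  fix U :: "nat \<Rightarrow> (nat \<Rightarrow> bool) set" assume U: "A \<subseteq> (\<Union>i. U i)"
  interpret prob_space coins by (rule prob_space_coins)
  \<comment> \<open>\<open>Y\<close> overwrites the coding positions by \<open>z\<close>, which puts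
    every outcome into \<open>A\<close>.\<close>
  define Y where "Y w k = (if m dvd k then z (k div m) else w k)" for w k
  have "\<exists>E\<in>sets coins. {w. Y w \<in> U i} \<subseteq> E \<and> measure coins E \<le> 2 * cdiam (U i) powr s" for i
    by (rule coins_cover[OF m s]) (simp add: Y_def)
  then obtain E where E: "\<And>i. E i \<in> sets coins" "\<And>i. {w. Y w \<in> U i} \<subseteq> E i"
    "\<And>i. measure coins (E i) \<le> 2 * cdiam (U i) powr s"
    by metis
  have "Y w \<in> A" for w using m(1) by (intro A) (simp add: Y_def)
  then have "(\<Union>i. E i) = space coins" using U E(2) by fastforce
  then have "1 = emeasure coins (\<Union>i. E i)" by (simp only: emeasure_space_1)
  also have "\<dots> \<le> (\<Sum>i. emeasure coins (E i))"
    using E(1) by (intro emeasure_subadditive_countably) auto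
  also have "\<dots> \<le> (\<Sum>i. 2 * ennreal (cdiam (U i) powr s))"
  proof (intro suminf_le)
    fix i
    have "emeasure coins (E i) \<le> ennreal (2 * cdiam (U i) powr s)"
      using E(3) by (simp add: emeasure_eq_measure ennreal_leI)
    then show "emeasure coins (E i) \<le> 2 * ennreal (cdiam (U i) powr s)"
      by (simp add: ennreal_mult)
  qed auto
  finally have "1 \<le> 2 * (\<Sum>i. ennreal (cdiam (U i) powr s))" by simp
  then have "ennreal (1/2) * 1 \<le> ennreal (1/2) * (2 * (\<Sum>i. ennreal (cdiam (U i) powr s)))"
    by (intro mult_left_mono) auto
  also have "\<dots> = (ennreal (1/2) * ennreal 2) * (\<Sum>i. ennreal (cdiam (U i) powr s))"
    by (simp add: mult.assoc)
  also have "ennreal (1/2) * ennreal 2 = 1"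
    by (subst ennreal_mult[symmetric]) auto
  finally show "ennreal (1/2) \<le> (\<Sum>i. ennreal (cdiam (U i) powr s))" by simp
qed (subst ennreal_less_zero_iff, simp)

theorem mainTheorem14:
  fixes s :: real
  assumes "s \<in> \<rat>" and "0 < s" and "s < 1"
  shows "\<exists>G. pi02_class G \<and> hausdorff s G > 0 \<and>
           (\<forall>x. (\<exists>P. pi01_class_rel x P \<and> P \<subseteq> G \<and> hausdorff s P > 0) \<longrightarrow>
                (\<forall>H. hyperarithmetic H \<longrightarrow> turing_le (\<lambda>n. n \<in> H) x))"
proof -
  \<comment> \<open>Take \<open>m\<close> with \<open>1 / m\<close> below \<open>1 - s\<close>, so
    that the coding positions are sparse enough for dimension \<open>s\<close>.\<close>
  obtain k where k: "inverse (real (Suc k)) < 1 - s"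
    using reals_Archimedean[of "1 - s"] assms(3) by auto
  define m where "m = Suc k"
  have m: "m > 0" "1 / real m \<le> 1 - s"
    using k by (simp_all add: m_def inverse_eq_divide)
  obtain z where "\<And>y. (\<And>p. y (m * p) = z p) \<Longrightarrow> y \<in> comparison_class m"
    using comparison_class_inhabited[OF m(1)] by blast
  then have "hausdorff s (comparison_class m) > 0"
    by (rule hausdorff_pos_of_free_bits[OF m assms(2)])
  moreover have "turing_le (\<lambda>n. n \<in> H) x"
    if "pi01_class_rel x P" "P \<subseteq> comparison_class m" "hausdorff s P > 0" "hyperarithmetic H" for x P H
  proof -
    \<comment> \<open>Positive measure supplies the member of \<open>P\<close> that the search for
      the common bits relies on.\<close>
    have "P \<noteq> {}" using that(3) by (auto simp: hausdorff_empty)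
    then show ?thesis using hyperarithmetic_turing_le that by blast
  qed
  ultimately show ?thesis using pi02_class_comparison_class by blast
qed

end
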